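(* Let $W=(x_1,\dots,x_n,f(x_1,\dots,x_n))$ be a local $(n+1)$-web of codimension 1 near the origin of $\mathbb R^n$. If $W$ is not parallelizable, then its Lie algebra $\mathfrak g$ of infinitesimal isomorphisms has dimension at most $n$.
   Context: Everything is local near the origin of $\mathbb R^n$, and all functions and vector fields are real analytic. A $d$-web of codimension 1 is a family of $d$ foliations of codimension 1, any $n$ of which are transverse; it is denoted by its first integrals $(f_1,\dots,f_d)$. Here $W=(x_1,\dots,x_n,f)$ with all partial derivatives $\partial f/\partial x_i$ non-vanishing. The web is parallelizable if there are local coordinates in which all its foliations admit linear first integrals. An infinitesimal isomorphism of $W$ is a vector field whose flow preserves each of the $n+1$ foliations, i.e. a vector field $X=\sum_iX_i(x_i)\,\partial/\partial x_i$ with $X\cdot f=\phi\circ f$ for some function $\phi$ of one variable. *)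

theory Defs
  imports "HOL-Analysis.Analysis"
begin

text \<open>Local convergence of a multivariate power series. Multi-indices are the extensional
  functions from \<open>Basis\<close> to the naturals, so the definition covers functions of one variable
  (where \<open>Basis = {1}\<close>), functions on \<open>real ^ 'n\<close> and vector-valued maps alike.\<close>

definition real_analytic_at :: "('a::euclidean_space \<Rightarrow> 'b::real_normed_vector) \<Rightarrow> 'a \<Rightarrow> bool" where
  "real_analytic_at f p \<longleftrightarrow>
     (\<exists>a :: ('a \<Rightarrow> nat) \<Rightarrow> 'b. \<forall>\<^sub>F x in nhds p.
        ((\<lambda>\<alpha>. (\<Prod>b\<in>Basis. ((x - p) \<bullet> b) ^ \<alpha> b) *\<^sub>R a \<alpha>) has_sum f x) (Basis \<rightarrow>\<^sub>E UNIV))"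

text \<open>A germ at the origin of a codimension 1 foliation is given by a submersion \<open>u\<close>; its leaves
  are the level sets of \<open>u\<close>, with tangent spaces the kernels of the differential of \<open>u\<close>.\<close>

definition leaf_tangent :: "(real ^ 'n \<Rightarrow> real) \<Rightarrow> real ^ 'n \<Rightarrow> (real ^ 'n) set" where
  "leaf_tangent u x = {w. frechet_derivative u (at x) w = 0}"

definition analytic_submersion :: "(real ^ 'n \<Rightarrow> real) \<Rightarrow> bool" where
  "analytic_submersion u \<longleftrightarrow>
     real_analytic_at u 0 \<and> (\<forall>\<^sub>F x in nhds 0. leaf_tangent u x \<noteq> UNIV)"

definition first_integral_of :: "(real ^ 'n \<Rightarrow> real) \<Rightarrow> (real ^ 'n \<Rightarrow> real) \<Rightarrow> bool" where
  "first_integral_of u v \<longleftrightarrow>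
     analytic_submersion v \<and> (\<forall>\<^sub>F x in nhds 0. leaf_tangent v x = leaf_tangent u x)"

text \<open>Transversality of \<open>n\<close> hyperplanes in \<open>n\<close>-space: their intersection has codimension \<open>n\<close>,
  i.e. it is zero.\<close>

definition web :: "('d::finite \<Rightarrow> real ^ 'n \<Rightarrow> real) \<Rightarrow> bool" where
  "web F \<longleftrightarrow>
     (\<forall>j. analytic_submersion (F j)) \<and>
     (\<forall>\<^sub>F x in nhds 0. \<forall>J. card J = CARD('n) \<longrightarrow> (\<Inter>j\<in>J. leaf_tangent (F j) x) = {0})"

definition local_coordinates :: "(real ^ 'n \<Rightarrow> real ^ 'n) \<Rightarrow> bool" where
  "local_coordinates \<Phi> \<longleftrightarrow>
     real_analytic_at \<Phi> 0 \<and>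
     (\<exists>\<Psi>. real_analytic_at \<Psi> (\<Phi> 0) \<and>
        (\<forall>\<^sub>F x in nhds 0. \<Psi> (\<Phi> x) = x) \<and> (\<forall>\<^sub>F y in nhds (\<Phi> 0). \<Phi> (\<Psi> y) = y))"

definition parallelizable :: "('d::finite \<Rightarrow> real ^ 'n \<Rightarrow> real) \<Rightarrow> bool" where
  "parallelizable F \<longleftrightarrow>
     (\<exists>\<Phi>. local_coordinates \<Phi> \<and> (\<forall>j. \<exists>l. linear l \<and> first_integral_of (F j) (l \<circ> \<Phi>)))"

text \<open>The web \<open>(x\<^sub>1, \<dots>, x\<^sub>n, f)\<close>.\<close>

definition coordinate_web :: "(real ^ 'n \<Rightarrow> real) \<Rightarrow> 'n option \<Rightarrow> real ^ 'n \<Rightarrow> real" where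
  "coordinate_web f j = (case j of Some i \<Rightarrow> (\<lambda>x. x $ i) | None \<Rightarrow> f)"

text \<open>\<open>\<xi> i\<close> is the coefficient of \<open>\<partial>/\<partial>x\<^sub>i\<close>, a function of \<open>x\<^sub>i\<close> alone.\<close>

definition infinitesimal_isomorphism ::
    "(real ^ 'n \<Rightarrow> real) \<Rightarrow> (real ^ 'n \<Rightarrow> real ^ 'n) \<Rightarrow> bool" where
  "infinitesimal_isomorphism f X \<longleftrightarrow>
     (\<exists>\<xi> \<phi>. (\<forall>i. real_analytic_at (\<xi> i) (0::real)) \<and> real_analytic_at \<phi> (f 0) \<and>
        (\<forall>\<^sub>F x in nhds 0. X x = (\<chi> i. \<xi> i (x $ i))) \<and>
        (\<forall>\<^sub>F x in nhds 0. frechet_derivative f (at x) (X x) = \<phi> (f x)))"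

text \<open>Germs at the origin of vector fields on \<open>n\<close>-space.\<close>

quotient_type (overloaded) 'n vector_field_germ =
    "real ^ 'n \<Rightarrow> real ^ ('n::finite)" / "\<lambda>X Y. \<forall>\<^sub>F x in nhds 0. X x = Y x"
  morphisms rep_germ germ
proof (rule equivpI)
  show "reflp (\<lambda>X Y :: real ^ 'n \<Rightarrow> real ^ 'n. \<forall>\<^sub>F x in nhds 0. X x = Y x)"
    by (simp add: reflp_def)
  show "symp (\<lambda>X Y :: real ^ 'n \<Rightarrow> real ^ 'n. \<forall>\<^sub>F x in nhds 0. X x = Y x)"
    by (simp add: symp_def eq_commute)
  show "transp (\<lambda>X Y :: real ^ 'n \<Rightarrow> real ^ 'n. \<forall>\<^sub>F x in nhds 0. X x = Y x)"
    unfolding transp_def by (auto elim: eventually_elim2)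
qed

instantiation vector_field_germ :: (finite) real_vector
begin

lift_definition zero_vector_field_germ :: "'a vector_field_germ" is "\<lambda>_. 0" .

lift_definition plus_vector_field_germ ::
    "'a vector_field_germ \<Rightarrow> 'a vector_field_germ \<Rightarrow> 'a vector_field_germ"
  is "\<lambda>X Y x. X x + Y x" by (auto elim: eventually_elim2)

lift_definition minus_vector_field_germ ::
    "'a vector_field_germ \<Rightarrow> 'a vector_field_germ \<Rightarrow> 'a vector_field_germ"
  is "\<lambda>X Y x. X x - Y x" by (auto elim: eventually_elim2)

lift_definition uminus_vector_field_germ :: "'a vector_field_germ \<Rightarrow> 'a vector_field_germ"
  is "\<lambda>X x. - X x" by (auto elim: eventually_mono)

lift_definition scaleR_vector_field_germ :: "real \<Rightarrow> 'a vector_field_germ \<Rightarrow> 'a vector_field_germ"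
  is "\<lambda>c X x. c *\<^sub>R X x" by (auto elim: eventually_mono)

instance
  by standard (transfer, simp add: algebra_simps)+

end

definition isomorphism_algebra :: "(real ^ 'n \<Rightarrow> real) \<Rightarrow> 'n vector_field_germ set" where
  "isomorphism_algebra f = {germ X | X. infinitesimal_isomorphism f X}"

end

theory Submission
  imports Defs "HOL-Complex_Analysis.Conformal_Mappings"
begin

text \<open>Evaluation at the origin is injective on the algebra of infinitesimal isomorphisms, so its
  dimension is at most \<open>n\<close>. Let \<open>X = (\<xi>\<^sub>1(x\<^sub>1), \<dots>, \<xi>\<^sub>n(x\<^sub>n))\<close> vanish at \<open>0\<close>, with \<open>X f = \<phi> \<circ> f\<close>, and
  write \<open>c\<^sub>i\<close> for the \<open>i\<close>-th partial derivative of \<open>f\<close> at \<open>0\<close>, which is nonzero. If \<open>\<xi>\<^sub>i\<close> and \<open>\<phi>\<close>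
  vanish to order \<open>k\<close> with coefficients \<open>a\<^sub>i\<close> and \<open>d\<close> of degree \<open>k\<close>, comparing the lowest order terms
  gives \<open>\<Sum>\<^sub>i c\<^sub>i a\<^sub>i x\<^sub>i\<^sup>k = d (\<Sum>\<^sub>i c\<^sub>i x\<^sub>i)\<^sup>k\<close>. For \<open>k = 1\<close> this says that all \<open>a\<^sub>i\<close> equal
  \<open>d\<close>. If \<open>d \<noteq> 0\<close>, the one-variable fields \<open>\<xi>\<^sub>i\<close> and \<open>\<phi>\<close> can be linearised analytically; in the new
  coordinates \<open>f\<close> is homogeneous of degree 1 and differentiable at \<open>0\<close>, hence linear, and the web is
  parallelizable. If \<open>d = 0\<close>, the identity for \<open>k \<ge> 2\<close> (and \<open>n \<ge> 2\<close>) forces all higher coefficients to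
  vanish successively, so \<open>X = 0\<close>. For \<open>n = 1\<close> every web is parallelizable.\<close>

subsection \<open>Real analytic functions\<close>

text \<open>On the line \<open>Basis = {1}\<close>, so a multi-index is determined by its value at
  \<open>1\<close>; reindexing along this bijection turns the sum over multi-indices into a sum over
  the naturals.\<close>

lemma real_analytic_at_real_iff_has_sum:
  fixes h :: "real \<Rightarrow> real"
  shows "real_analytic_at h p \<longleftrightarrow>
    (\<exists>c. \<forall>\<^sub>F x in nhds p. ((\<lambda>n. c n * (x - p) ^ n) has_sum h x) UNIV)"
proof -
  let ?e = "\<lambda>n::nat. \<lambda>b\<in>{1::real}. n"
  have bij: "bij_betw ?e UNIV ({1} \<rightarrow>\<^sub>E UNIV)"
    by (rule bij_betw_byWitness[where f' = "\<lambda>\<alpha>. \<alpha> 1"])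
       (auto simp: PiE_iff extensional_def fun_eq_iff split: if_splits)
  have eq: "((\<lambda>\<alpha>. (\<Prod>b\<in>Basis. ((x - p) \<bullet> b) ^ \<alpha> b) *\<^sub>R a \<alpha>) has_sum h x) (Basis \<rightarrow>\<^sub>E UNIV) \<longleftrightarrow>
      ((\<lambda>n. a (?e n) * (x - p) ^ n) has_sum h x) UNIV" for a :: "(real \<Rightarrow> nat) \<Rightarrow> real" and x
    using has_sum_reindex_bij_betw[OF bij, of "\<lambda>\<alpha>. (x - p) ^ \<alpha> 1 * a \<alpha>" "h x"]
    by (simp add: mult.commute)
  show ?thesis
  proof
    assume "real_analytic_at h p"
    then obtain a where "\<forall>\<^sub>F x in nhds p. ((\<lambda>n. a (?e n) * (x - p) ^ n) has_sum h x) UNIV"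
      unfolding real_analytic_at_def eq by blast
    then show "\<exists>c. \<forall>\<^sub>F x in nhds p. ((\<lambda>n. c n * (x - p) ^ n) has_sum h x) UNIV"
      by (intro exI[of _ "\<lambda>n. a (?e n)"])
  next
    assume "\<exists>c. \<forall>\<^sub>F x in nhds p. ((\<lambda>n. c n * (x - p) ^ n) has_sum h x) UNIV"
    then obtain c where "\<forall>\<^sub>F x in nhds p. ((\<lambda>n. c n * (x - p) ^ n) has_sum h x) UNIV" ..
    then show "real_analytic_at h p"
      unfolding real_analytic_at_def eq by (intro exI[of _ "\<lambda>\<alpha>. c (\<alpha> 1)"]) simp
  qed
qed

text \<open>A power series that converges at some \<open>s\<close> beyond \<bar>x - p\<bar>
  converges absolutely at \<open>x\<close>, so the ordered and the unconditional sums agree near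
  \<open>p\<close>. This gives access to the library on ordinary power series.\<close>

lemma real_analytic_at_real_iff_sums:
  fixes h :: "real \<Rightarrow> real"
  shows "real_analytic_at h p \<longleftrightarrow>
    (\<exists>c. \<forall>\<^sub>F x in nhds p. (\<lambda>n. c n * (x - p) ^ n) sums h x)"
  unfolding real_analytic_at_real_iff_has_sum
proof
  assume "\<exists>c. \<forall>\<^sub>F x in nhds p. ((\<lambda>n. c n * (x - p) ^ n) has_sum h x) UNIV"
  then show "\<exists>c. \<forall>\<^sub>F x in nhds p. (\<lambda>n. c n * (x - p) ^ n) sums h x"
    by (auto elim!: eventually_mono intro: has_sum_imp_sums)
next
  assume "\<exists>c. \<forall>\<^sub>F x in nhds p. (\<lambda>n. c n * (x - p) ^ n) sums h x"
  then obtain c r where "r > 0" and c: "\<And>x. dist x p < r \<Longrightarrow> (\<lambda>n. c n * (x - p) ^ n) sums h x"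
    unfolding eventually_nhds_metric by blast
  have "((\<lambda>n. c n * (x - p) ^ n) has_sum h x) UNIV" if x: "dist x p < r" for x
  proof (rule norm_summable_imp_has_sum)
    obtain s where s: "\<bar>x - p\<bar> < s" "s < r"
      using x dense[of "\<bar>x - p\<bar>" r] by (auto simp: dist_real_def)
    have "summable (\<lambda>n. c n * s ^ n)"
      using c[of "p + s"] s by (auto simp: dist_real_def sums_iff)
    then show "summable (\<lambda>n. norm (c n * (x - p) ^ n))"
      by (rule powser_insidea) (use s in auto)
  qed (use c x in auto)
  then show "\<exists>c. \<forall>\<^sub>F x in nhds p. ((\<lambda>n. c n * (x - p) ^ n) has_sum h x) UNIV"
    unfolding eventually_nhds_metric using \<open>r > 0\<close> by blast
qed

lemma real_analytic_at_add:
  assumes "real_analytic_at f p" "real_analytic_at g p"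
  shows "real_analytic_at (\<lambda>x. f x + g x) p"
proof -
  obtain a b where
    "\<forall>\<^sub>F x in nhds p. ((\<lambda>\<alpha>. (\<Prod>b\<in>Basis. ((x - p) \<bullet> b) ^ \<alpha> b) *\<^sub>R a \<alpha>) has_sum f x) (Basis \<rightarrow>\<^sub>E UNIV)"
    "\<forall>\<^sub>F x in nhds p. ((\<lambda>\<alpha>. (\<Prod>b\<in>Basis. ((x - p) \<bullet> b) ^ \<alpha> b) *\<^sub>R b \<alpha>) has_sum g x) (Basis \<rightarrow>\<^sub>E UNIV)"
    using assms unfolding real_analytic_at_def by blast
  hence "\<forall>\<^sub>F x in nhds p. ((\<lambda>\<alpha>. (\<Prod>b\<in>Basis. ((x - p) \<bullet> b) ^ \<alpha> b) *\<^sub>R (a \<alpha> + b \<alpha>)) has_sum f x + g x)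
      (Basis \<rightarrow>\<^sub>E UNIV)"
    unfolding scaleR_add_right by eventually_elim (rule has_sum_add)
  then show ?thesis
    unfolding real_analytic_at_def by (intro exI[of _ "\<lambda>\<alpha>. a \<alpha> + b \<alpha>"])
qed

lemma real_analytic_at_bounded_linear:
  assumes "bounded_linear T" "real_analytic_at f p"
  shows "real_analytic_at (\<lambda>x. T (f x)) p"
proof -
  interpret T: bounded_linear T by fact
  obtain a where
    "\<forall>\<^sub>F x in nhds p. ((\<lambda>\<alpha>. (\<Prod>b\<in>Basis. ((x - p) \<bullet> b) ^ \<alpha> b) *\<^sub>R a \<alpha>) has_sum f x) (Basis \<rightarrow>\<^sub>E UNIV)"
    using assms unfolding real_analytic_at_def by blast
  hence "\<forall>\<^sub>F x in nhds p. ((\<lambda>\<alpha>. (\<Prod>b\<in>Basis. ((x - p) \<bullet> b) ^ \<alpha> b) *\<^sub>R T (a \<alpha>)) has_sum T (f x))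
      (Basis \<rightarrow>\<^sub>E UNIV)"
    unfolding T.scaleR[symmetric] by eventually_elim (rule has_sum_bounded_linear[OF assms(1)])
  then show ?thesis
    unfolding real_analytic_at_def by (intro exI[of _ "\<lambda>\<alpha>. T (a \<alpha>)"])
qed

lemma real_analytic_at_zero: "real_analytic_at (\<lambda>_. 0) p"
  unfolding real_analytic_at_def by (intro exI[of _ "\<lambda>_. 0"]) simp

lemma real_analytic_at_sum:
  assumes "\<And>i. i \<in> I \<Longrightarrow> real_analytic_at (f i) p"
  shows "real_analytic_at (\<lambda>x. \<Sum>i\<in>I. f i x) p"
  using assms
  by (induction I rule: infinite_finite_induct)
     (auto intro: real_analytic_at_add real_analytic_at_zero)

lemma real_analytic_at_inner_Basis:
  fixes h :: "real \<Rightarrow> real" and p :: "'a::euclidean_space"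
  assumes "real_analytic_at h (p \<bullet> b)" and b: "b \<in> Basis"
  shows "real_analytic_at (\<lambda>x. h (x \<bullet> b)) p"
proof -
  let ?e = "\<lambda>n. \<lambda>b'\<in>Basis. if b' = b then n else (0::nat)"
  obtain c where c: "\<forall>\<^sub>F x in nhds (p \<bullet> b). ((\<lambda>n. c n * (x - p \<bullet> b) ^ n) has_sum h x) UNIV"
    using assms(1) unfolding real_analytic_at_real_iff_has_sum by blast
  \<comment> \<open>The one-variable coefficients are placed on the multi-indices supported in
    direction \<open>b\<close>, and all mixed coefficients are 0.\<close>
  define a where "a \<alpha> = (if \<alpha> \<in> range ?e then c (\<alpha> b) else 0)" for \<alpha> :: "'a \<Rightarrow> nat"
  have "((\<lambda>\<alpha>. (\<Prod>b\<in>Basis. ((x - p) \<bullet> b) ^ \<alpha> b) *\<^sub>R a \<alpha>) has_sum h (x \<bullet> b)) (Basis \<rightarrow>\<^sub>E UNIV)"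
    if *: "((\<lambda>n. c n * (x \<bullet> b - p \<bullet> b) ^ n) has_sum h (x \<bullet> b)) UNIV" for x
  proof -
    have inj: "inj ?e"
    proof (rule injI)
      fix m n assume "?e m = ?e n"
      from fun_cong[OF this, of b] show "m = n" using b by simp
    qed
    have e: "(\<Prod>b'\<in>Basis. ((x - p) \<bullet> b') ^ ?e n b') *\<^sub>R a (?e n) = c n * (x \<bullet> b - p \<bullet> b) ^ n" for n
    proof -
      have "(\<Prod>b'\<in>Basis. ((x - p) \<bullet> b') ^ ?e n b') =
          (\<Prod>b'\<in>Basis. if b' = b then (x \<bullet> b - p \<bullet> b) ^ n else 1)"
        by (intro prod.cong) (auto simp: inner_diff_left)
      also have "\<dots> = (x \<bullet> b - p \<bullet> b) ^ n" using b by simp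
      finally show ?thesis using b unfolding a_def by simp
    qed
    have "((\<lambda>\<alpha>. (\<Prod>b\<in>Basis. ((x - p) \<bullet> b) ^ \<alpha> b) *\<^sub>R a \<alpha>) has_sum h (x \<bullet> b)) (range ?e)"
      unfolding has_sum_reindex[OF inj] o_def e by (rule *)
    moreover have "range ?e \<subseteq> Basis \<rightarrow>\<^sub>E UNIV" by auto
    ultimately show ?thesis
      by (subst (asm) has_sum_cong_neutral[where T = "Basis \<rightarrow>\<^sub>E UNIV"]) (auto simp: a_def)
  qed
  moreover have "filterlim (\<lambda>x. x \<bullet> b) (nhds (p \<bullet> b)) (nhds p)"
    by (intro tendsto_intros filterlim_ident)
  ultimately show ?thesis
    unfolding real_analytic_at_def
    by (intro exI[of _ a] eventually_mono[OF eventually_compose_filterlim[OF c]])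
qed

text \<open>Termwise differentiation: the differentials of the monomials are dominated by a summable
  sequence on a smaller ball, so their series converges uniformly there and its sum is a continuous
  derivative.\<close>

lemma real_analytic_at_C1:
  fixes f :: "'a::euclidean_space \<Rightarrow> real"
  assumes "real_analytic_at f p"
  obtains f' :: "'a \<Rightarrow> 'a \<Rightarrow>\<^sub>L real"
  where "\<forall>\<^sub>F x in nhds p. (f has_derivative f' x) (at x)" "isCont f' p"
proof -
  let ?A = "(Basis :: 'a set) \<rightarrow>\<^sub>E (UNIV :: nat set)"
  obtain a :: "('a \<Rightarrow> nat) \<Rightarrow> real" and R where "R > 0" and a: "\<And>x. dist x p < R \<Longrightarrow>
      ((\<lambda>\<alpha>. (\<Prod>b\<in>Basis. ((x - p) \<bullet> b) ^ \<alpha> b) *\<^sub>R a \<alpha>) has_sum f x) ?A"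
    using assms unfolding real_analytic_at_def eventually_nhds_metric by blast
  \<comment> \<open>Enumerating the multi-indices makes the unconditional sum an ordinary series, as
    the theorem on derivatives of series requires.\<close>
  define e where "e = from_nat_into ?A"
  have "countable ?A"
    by (intro countable_PiE) auto
  moreover have "infinite ?A"
    by (auto simp: finite_PiE_iff PiE_eq_empty_iff)
  ultimately have e: "bij_betw e UNIV ?A"
    unfolding e_def by (rule bij_betw_from_nat_into)
  define m where "m n x = a (e n) * (\<Prod>b\<in>Basis. ((x - p) \<bullet> b) ^ e n b)" for n x
  have m: "((\<lambda>n. m n x) has_sum f x) UNIV" if "dist x p < R" for x
    using a[OF that] has_sum_reindex_bij_betw[OF e, of "\<lambda>\<alpha>. (\<Prod>b\<in>Basis. ((x - p) \<bullet> b) ^ \<alpha> b) *\<^sub>R a \<alpha>" "f x"]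
    by (simp add: m_def mult.commute)
  \<comment> \<open>This choice puts the corner \<open>p + r *\<^sub>R \<Sum>Basis\<close> of the
    cube with half-side \<open>r\<close> inside the region of convergence. Absolute convergence at
    that corner bounds all monomials on the cube.\<close>
  define r where "r = R / (norm (\<Sum>Basis :: 'a) + 1)"
  have r: "0 < r" "r \<le> R" and rR: "dist (p + r *\<^sub>R \<Sum>Basis) p < R"
    using \<open>R > 0\<close> by (auto simp: r_def dist_norm field_simps add_pos_nonneg)
  define D :: "nat \<Rightarrow> 'a \<Rightarrow> 'a \<Rightarrow>\<^sub>L real" where
    "D n x = (\<Sum>b\<in>Basis. (a (e n) * (e n b * ((x - p) \<bullet> b) ^ (e n b - 1) *
       (\<Prod>b'\<in>Basis - {b}. ((x - p) \<bullet> b') ^ e n b'))) *\<^sub>R blinfun_inner_left b)" for n x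
  have D: "(m n has_derivative D n x) (at x within S)" for n x S
    unfolding m_def D_def
    by (rule has_derivative_eq_rhs, (rule derivative_intros)+)
       (auto simp: fun_eq_iff blinfun.sum_left blinfun.scaleR_left sum_distrib_left mult_ac intro!: sum.cong)
  \<comment> \<open>One summand per basis direction; the factor \<open>2 / r\<close> is the price of
    differentiating once on the half-size ball.\<close>
  define M where "M n = DIM('a) * (\<bar>a (e n)\<bar> * (2 / r * (\<Prod>b\<in>Basis. r ^ e n b)))" for n
  have "(\<lambda>n. m n (p + r *\<^sub>R \<Sum>Basis)) summable_on UNIV"
    using m[OF rR] by (rule has_sum_imp_summable)
  hence "(\<lambda>n. \<bar>m n (p + r *\<^sub>R \<Sum>Basis)\<bar>) summable_on UNIV"
    using summable_on_iff_abs_summable_on_real by fastforce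
  hence "summable (\<lambda>n. \<bar>m n (p + r *\<^sub>R \<Sum>Basis)\<bar>)"
    by (subst (asm) summable_on_UNIV_nonneg_real_iff) auto
  hence "summable (\<lambda>n. \<bar>a (e n)\<bar> * (\<Prod>b\<in>Basis. r ^ e n b))"
    using r by (simp add: m_def abs_mult abs_prod power_abs)
  hence "summable (\<lambda>n. DIM('a) * (2 / r * (\<bar>a (e n)\<bar> * (\<Prod>b\<in>Basis. r ^ e n b))))"
    by (intro summable_mult)
  hence M: "summable M"
    unfolding M_def by (simp only: mult.left_commute[of _ "2 / r"])
  let ?S = "ball p (r / 2)"
  have DM: "norm (D n x) \<le> M n" if x: "x \<in> ?S" for n x
  proof -
    have xb: "\<bar>(x - p) \<bullet> b\<bar> \<le> r / 2" if "b \<in> Basis" for b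
      using Basis_le_norm[OF that, of "x - p"] x by (auto simp: dist_norm norm_minus_commute)
    have "norm ((a (e n) * (e n b * ((x - p) \<bullet> b) ^ (e n b - 1) *
       (\<Prod>b'\<in>Basis - {b}. ((x - p) \<bullet> b') ^ e n b'))) *\<^sub>R (blinfun_inner_left b :: 'a \<Rightarrow>\<^sub>L real))
       \<le> \<bar>a (e n)\<bar> * (2 / r * (\<Prod>b\<in>Basis. r ^ e n b))" if b: "b \<in> Basis" for b
    proof -
      \<comment> \<open>The exponent \<open>m\<close> produced by differentiation is absorbed by
        \<open>m \<le> 2 ^ m\<close>, which turns powers of \<open>r / 2\<close> into powers of
        \<open>r\<close>.\<close>
      have 1: "e n b * \<bar>(x - p) \<bullet> b\<bar> ^ (e n b - 1) \<le> 2 / r * r ^ e n b"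
      proof (cases "e n b")
        case (Suc k)
        have "real (Suc k) \<le> 2 ^ Suc k"
          using of_nat_less_two_power less_imp_le by blast
        hence "real (Suc k) * (r / 2) ^ k \<le> 2 ^ Suc k * (r / 2) ^ k"
          using r by (intro mult_right_mono) auto
        also have "\<dots> = 2 / r * r ^ Suc k"
          using r by (simp add: power_divide)
        finally have "real (Suc k) * (r / 2) ^ k \<le> 2 / r * r ^ Suc k" .
        moreover have "real (Suc k) * \<bar>(x - p) \<bullet> b\<bar> ^ k \<le> real (Suc k) * (r / 2) ^ k"
          using xb[OF b] by (intro mult_left_mono power_mono) auto
        ultimately have "real (Suc k) * \<bar>(x - p) \<bullet> b\<bar> ^ k \<le> 2 / r * r ^ Suc k" by linarith
        then show ?thesis using Suc by (simp only: diff_Suc_1)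
      qed (use r in simp)
      have 2: "(\<Prod>b'\<in>Basis - {b}. \<bar>(x - p) \<bullet> b'\<bar> ^ e n b') \<le> (\<Prod>b'\<in>Basis - {b}. r ^ e n b')"
      proof (intro prod_mono conjI power_mono)
        fix b' assume "b' \<in> (Basis :: 'a set) - {b}"
        with xb[of b'] r show "\<bar>(x - p) \<bullet> b'\<bar> \<le> r" by auto
      qed auto
      have 3: "norm (blinfun_inner_left b :: 'a \<Rightarrow>\<^sub>L real) \<le> 1"
        using b by (intro norm_blinfun_bound) (auto simp: Basis_le_norm)
      have "norm ((a (e n) * (e n b * ((x - p) \<bullet> b) ^ (e n b - 1) *
          (\<Prod>b'\<in>Basis - {b}. ((x - p) \<bullet> b') ^ e n b'))) *\<^sub>R (blinfun_inner_left b :: 'a \<Rightarrow>\<^sub>L real))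
        = \<bar>a (e n)\<bar> * (e n b * \<bar>(x - p) \<bullet> b\<bar> ^ (e n b - 1) *
          (\<Prod>b'\<in>Basis - {b}. \<bar>(x - p) \<bullet> b'\<bar> ^ e n b')) * norm (blinfun_inner_left b :: 'a \<Rightarrow>\<^sub>L real)"
        by (simp add: abs_mult abs_prod power_abs)
      also have "\<dots> \<le> \<bar>a (e n)\<bar> * ((2 / r * r ^ e n b) * (\<Prod>b'\<in>Basis - {b}. r ^ e n b')) * 1"
        by (rule mult_mono[OF mult_left_mono[OF mult_mono[OF 1 2]] 3])
           (use r in \<open>auto intro!: mult_nonneg_nonneg divide_nonneg_pos prod_nonneg\<close>)
      also have "\<dots> = \<bar>a (e n)\<bar> * (2 / r * (\<Prod>b\<in>Basis. r ^ e n b))"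
        using b by (simp add: prod.remove[of _ b])
      finally show ?thesis .
    qed
    then show ?thesis
      unfolding D_def M_def by (intro order_trans[OF norm_sum] order_trans[OF sum_bounded_above]) auto
  qed
  define f' where "f' x = (\<Sum>n. D n x)" for x
  have lim: "uniform_limit ?S (\<lambda>n x. \<Sum>i<n. D i x) f' sequentially"
    unfolding f'_def by (rule Weierstrass_m_test[OF DM M])
  have "\<exists>g. \<forall>x\<in>?S. (\<lambda>n. m n x) sums g x \<and> (g has_derivative f' x) (at x within ?S)"
  proof (rule has_derivative_series)
    fix \<epsilon> :: real assume "\<epsilon> > 0"
    from uniform_limitD[OF lim this]
    show "\<forall>\<^sub>F n in sequentially. \<forall>x\<in>?S. \<forall>h. norm ((\<Sum>i<n. D i x h) - f' x h) \<le> \<epsilon> * norm h"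
    proof (eventually_elim, intro ballI allI)
      fix n x h assume "\<forall>x\<in>?S. dist (\<Sum>i<n. D i x) (f' x) < \<epsilon>" and "x \<in> ?S"
      hence "norm ((\<Sum>i<n. D i x) - f' x) \<le> \<epsilon>"
        by (auto simp: dist_norm intro: less_imp_le)
      hence "norm (((\<Sum>i<n. D i x) - f' x) h) \<le> \<epsilon> * norm h"
        by (meson mult_right_mono norm_blinfun norm_ge_zero order_trans)
      then show "norm ((\<Sum>i<n. D i x h) - f' x h) \<le> \<epsilon> * norm h"
        by (simp add: blinfun.diff_left blinfun.sum_left)
    qed
  next
    show "p \<in> ?S" using r by simp
    show "(\<lambda>n. m n p) sums f p" using \<open>R > 0\<close> by (intro has_sum_imp_sums m) auto
  qed (auto intro: D)
  then obtain g where g: "\<And>x. x \<in> ?S \<Longrightarrow> (\<lambda>n. m n x) sums g x"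
    "\<And>x. x \<in> ?S \<Longrightarrow> (g has_derivative f' x) (at x within ?S)"
    by blast
  have fg: "f x = g x" if "x \<in> ?S" for x
    using g(1)[OF that] has_sum_imp_sums[OF m[of x]] that r sums_unique2
    by (force simp: dist_commute)
  have "(f has_derivative f' x) (at x)" if "x \<in> ?S" for x
  proof -
    have "(f has_derivative f' x) (at x within ?S)"
      using g(2)[OF that] by (rule has_derivative_transform[OF that, rotated]) (use fg in auto)
    then show ?thesis using at_within_open[OF that] by simp
  qed
  hence "\<forall>\<^sub>F x in nhds p. (f has_derivative f' x) (at x)"
    using r by (intro eventually_nhds_in_open[THEN eventually_mono, of ?S]) auto
  moreover have "continuous_on ?S f'"
    by (rule uniform_limit_theorem[OF _ lim])
       (auto simp: D_def intro!: always_eventually continuous_intros)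
  hence "isCont f' p"
    using r by (simp add: continuous_on_eq_continuous_at)
  ultimately show thesis by (rule that)
qed

subsection \<open>Linearisation of analytic vector fields on the line\<close>

text \<open>At real points the powers of \<open>x - p\<close> are real, so taking real parts of the
  Taylor series acts on the coefficients alone.\<close>

lemma real_analytic_at_Re_holomorphic:
  assumes "F holomorphic_on ball (of_real p) r" "r > 0"
  shows "real_analytic_at (\<lambda>x. Re (F (of_real x))) p"
  unfolding real_analytic_at_real_iff_sums
proof (intro exI, rule eventually_mono)
  show "\<forall>\<^sub>F x in nhds p. dist x p < r"
    using assms by (auto simp: eventually_nhds_metric)
next
  let ?a = "\<lambda>n. (deriv ^^ n) F (of_real p) / fact n"
  fix x assume "dist x p < r"
  hence "of_real x \<in> ball (of_real p :: complex) r"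
    by (simp add: dist_commute dist_of_real)
  from sums_Re[OF holomorphic_power_series[OF assms(1) this]]
  have "(\<lambda>n. Re (?a n * of_real ((x - p) ^ n))) sums Re (F (of_real x))" by simp
  then show "(\<lambda>n. Re (?a n) * (x - p) ^ n) sums Re (F (of_real x))"
    by (simp only: times_complex.sel Re_complex_of_real Im_complex_of_real mult_zero_right diff_zero)
qed

lemma summable_complex_powser:
  fixes c :: "nat \<Rightarrow> real"
  assumes "\<And>x. \<bar>x\<bar> < r \<Longrightarrow> summable (\<lambda>n. c n * x ^ n)" and "norm z < r"
  shows "summable (\<lambda>n. of_real (c n) * (z :: complex) ^ n)"
proof -
  obtain s where s: "norm z < s" "s < r"
    using assms(2) dense by blast
  have "\<bar>s\<bar> < r" using s norm_ge_zero[of z] by linarith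
  from summable_of_real[OF assms(1)[OF this]]
  have "summable (\<lambda>n. of_real (c n) * (of_real s :: complex) ^ n)" by simp
  then show ?thesis
    by (rule powser_inside) (use s in auto)
qed

text \<open>The series of \<open>u\<close> is extended to a holomorphic \<open>F\<close> on a
  complex disc and inverted there; the real part of the holomorphic inverse is analytic. Real
  coefficients make \<open>F\<close> commute with conjugation, which forces the inverse to be real
  at real points.\<close>

lemma real_analytic_at_inverse_function:
  fixes u :: "real \<Rightarrow> real"
  assumes u: "real_analytic_at u p" and d: "(u has_real_derivative d) (at p)" "d \<noteq> 0"
  obtains v where "real_analytic_at v (u p)"
    "\<forall>\<^sub>F x in nhds p. v (u x) = x" "\<forall>\<^sub>F y in nhds (u p). u (v y) = y"
proof -
  obtain c r where "r > 0" and c: "\<And>x. dist x p < r \<Longrightarrow> (\<lambda>n. c n * (x - p) ^ n) sums u x"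
    using u unfolding real_analytic_at_real_iff_sums eventually_nhds_metric by blast
  let ?p = "complex_of_real p"
  define F where "F z = (\<Sum>n. of_real (c n) * (z - ?p) ^ n)" for z
  have "summable (\<lambda>n. c n * x ^ n)" if "\<bar>x\<bar> < r" for x
    using c[of "p + x"] that by (auto simp: dist_real_def sums_iff)
  hence F: "(\<lambda>n. of_real (c n) * (z - ?p) ^ n) sums F z" if "z \<in> ball ?p r" for z
    unfolding F_def using that
    by (intro summable_sums summable_complex_powser[of r]) (auto simp: dist_norm norm_minus_commute)
  have Fu: "F (of_real x) = of_real (u x)" if "dist x p < r" for x
  proof -
    have "(\<lambda>n. of_real (c n) * (of_real x - ?p) ^ n) sums of_real (u x)"
      using sums_of_real[OF c[OF that], where 'a = complex] by simp
    then show ?thesis unfolding F_def by (simp add: sums_iff)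
  qed
  have Fcnj: "F (cnj z) = cnj (F z)" if "z \<in> ball ?p r" for z
  proof -
    have "(\<lambda>n. cnj (of_real (c n) * (z - ?p) ^ n)) sums cnj (F z)"
      using F[OF that] by (simp only: sums_cnj)
    then show ?thesis unfolding F_def by (simp add: sums_iff)
  qed
  have hol: "F holomorphic_on ball ?p r"
    using F by (rule power_series_holomorphic)
  have "(F has_field_derivative deriv F ?p) (at ?p)"
    using hol \<open>r > 0\<close> by (intro holomorphic_derivI[where S = "ball ?p r"]) auto
  \<comment> \<open>Along the real axis \<open>F\<close> agrees with \<open>u\<close>, so uniqueness
    of derivatives identifies the complex derivative with \<open>d\<close>.\<close>
  hence "((\<lambda>x. F (of_real x)) has_vector_derivative deriv F ?p) (at p)"
    using has_vector_derivative_real_field by blast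
  moreover have "((\<lambda>x. F (of_real x)) has_vector_derivative of_real d) (at p)"
  proof (rule has_vector_derivative_transform_within)
    show "((\<lambda>x. complex_of_real (u x)) has_vector_derivative of_real d) (at p)"
      using d(1) by (rule has_vector_derivative_of_real)
  qed (use \<open>r > 0\<close> Fu in auto)
  ultimately have "deriv F ?p = of_real d"
    by (rule vector_derivative_unique_at)
  hence "deriv F ?p \<noteq> 0" using d by simp
  then obtain s where s: "s > 0" "ball ?p s \<subseteq> ball ?p r" "open (F ` ball ?p s)" "inj_on F (ball ?p s)"
    using has_complex_derivative_locally_invertible[OF hol, of ?p] \<open>r > 0\<close> by auto
  obtain G where G: "G holomorphic_on (F ` ball ?p s)" "\<And>z. z \<in> ball ?p s \<Longrightarrow> G (F z) = z"
    using holomorphic_has_inverse[OF holomorphic_on_subset[OF hol s(2)] open_ball s(4)] by metis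
  have "of_real (u p) \<in> F ` ball ?p s"
    using Fu[of p] \<open>r > 0\<close> \<open>s > 0\<close> by (metis centre_in_ball dist_self imageI)
  with s(3) obtain t where t: "t > 0" "ball (of_real (u p)) t \<subseteq> F ` ball ?p s"
    by (meson open_contains_ball)
  have sr: "dist x p < r" "of_real x \<in> ball ?p s" if "dist x p < s" for x
  proof -
    show *: "of_real x \<in> ball ?p s"
      using that by (simp add: dist_of_real dist_commute)
    with s(2) have "of_real x \<in> ball ?p r" by blast
    then show "dist x p < r" by (simp add: dist_of_real dist_commute)
  qed
  show thesis
  proof (rule that)
    show "real_analytic_at (\<lambda>y. Re (G (of_real y))) (u p)"
      using holomorphic_on_subset[OF G(1) t(2)] t(1) by (rule real_analytic_at_Re_holomorphic)
    have "Re (G (of_real (u x))) = x" if "dist x p < s" for x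
      using sr[OF that] G(2)[of "of_real x"] Fu[of x] by simp
    then show "\<forall>\<^sub>F x in nhds p. Re (G (of_real (u x))) = x"
      using \<open>s > 0\<close> unfolding eventually_nhds_metric by blast
    have "u (Re (G (of_real y))) = y" if "dist y (u p) < t" for y
    proof -
      have "of_real y \<in> ball (complex_of_real (u p)) t"
        using that by (simp add: dist_of_real dist_commute)
      then obtain z where z: "z \<in> ball ?p s" "F z = of_real y"
        using t(2) by (metis imageE subsetD)
      \<comment> \<open>Both \<open>z\<close> and its conjugate are mapped by \<open>F\<close> to
        the real number \<open>y\<close>; injectivity then makes \<open>z\<close> real.\<close>
      have "cnj z \<in> ball ?p s"
        using z(1) by (metis complex_cnj_complex_of_real complex_cnj_diff complex_mod_cnj dist_norm mem_ball)
      moreover have "F (cnj z) = F z"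
        using Fcnj[of z] z s(2) by (metis complex_cnj_complex_of_real subsetD)
      ultimately have "cnj z = z"
        using s(4) z(1) by (meson inj_onD)
      hence zr: "z = of_real (Re z)"
        by (metis Reals_cnj_iff of_real_Re)
      hence "dist (Re z) p < s"
        using z(1) by (metis dist_commute dist_of_real mem_ball)
      hence "F z = of_real (u (Re z))"
        using Fu[of "Re z"] sr(1) zr by metis
      then show ?thesis
        using z G(2)[OF z(1)] by simp
    qed
    then show "\<forall>\<^sub>F y in nhds (u p). u (Re (G (of_real y))) = y"
      using \<open>t > 0\<close> unfolding eventually_nhds_metric by blast
  qed
qed

text \<open>Writing \<open>\<xi> z = z q(z)\<close> and \<open>q(z) = \<lambda> + z q\<^sub>2(z)\<close>, the linearising coordinate is
  \<open>z exp P(z)\<close> with \<open>P' = - q\<^sub>2 / q\<close>.\<close>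

lemma real_analytic_linearization:
  fixes c :: "nat \<Rightarrow> real"
  assumes \<xi>: "\<forall>\<^sub>F x in nhds 0. (\<lambda>n. c n * x ^ n) sums \<xi> x" and c: "c 0 = 0" "c 1 \<noteq> 0"
  obtains u u' where "real_analytic_at u 0" "u 0 = 0" "u' 0 = 1"
    "\<forall>\<^sub>F x in nhds 0. (u has_real_derivative u' x) (at x) \<and> u' x \<noteq> 0 \<and> \<xi> x * u' x = c 1 * u x"
proof -
  obtain r where "r > 0" and r: "\<And>x. \<bar>x\<bar> < r \<Longrightarrow> (\<lambda>n. c n * x ^ n) sums \<xi> x"
    using \<xi> unfolding eventually_nhds_metric dist_real_def by auto
  have summ: "summable (\<lambda>n. of_real (c n) * z ^ n)" if "norm z < r" for z :: complex
    using summable_complex_powser[of r c z] r that by (auto simp: sums_iff)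
  define q where "q z = (\<Sum>n. of_real (c (Suc n)) * (z::complex) ^ n)" for z
  define q2 where "q2 z = (\<Sum>n. of_real (c (Suc (Suc n))) * (z::complex) ^ n)" for z
  have summ1: "summable (\<lambda>n. of_real (c (Suc n)) * z ^ n)" if "norm z < r" for z :: complex
    using summ[OF that] summable_powser_split_head[of "\<lambda>n. of_real (c n)" z] by simp
  have summ2: "summable (\<lambda>n. of_real (c (Suc (Suc n))) * z ^ n)" if "norm z < r" for z :: complex
    using summ1[OF that] summable_powser_split_head[of "\<lambda>n. of_real (c (Suc n))" z] by simp
  have q_eq: "q z = of_real (c 1) + z * q2 z" if "norm z < r" for z
    unfolding q_def q2_def using powser_split_head(1)[OF summ1[OF that]] by (simp add: mult.commute)
  have \<xi>_eq: "of_real (\<xi> x) = of_real x * q (of_real x)" if "\<bar>x\<bar> < r" for x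
  proof -
    have "of_real (\<xi> x) = (\<Sum>n. of_real (c n) * (of_real x :: complex) ^ n)"
      using sums_of_real[OF r[OF that], where 'a = complex] by (simp add: sums_iff)
    also have "\<dots> = of_real x * q (of_real x)"
      using powser_split_head(1)[OF summ[of "of_real x"]] that c by (simp add: q_def mult.commute)
    finally show ?thesis .
  qed
  have q: "q holomorphic_on ball 0 r"
    using summ1 by (intro power_series_holomorphic[of 0 r "\<lambda>n. of_real (c (Suc n))"])
      (auto simp: q_def intro: summable_sums)
  have q2: "q2 holomorphic_on ball 0 r"
    using summ2 by (intro power_series_holomorphic[of 0 r "\<lambda>n. of_real (c (Suc (Suc n)))"])
      (auto simp: q2_def intro: summable_sums)
  have "q 0 \<noteq> 0" using q_eq[of 0] \<open>r > 0\<close> c by simp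
  moreover have "isCont q 0"
    using holomorphic_on_imp_continuous_on[OF q] \<open>r > 0\<close> by (simp add: continuous_on_eq_continuous_at)
  ultimately obtain s where s: "s > 0" "\<And>z. norm z < s \<Longrightarrow> q z \<noteq> 0"
    using continuous_at_avoid[of 0 q 0] by (metis dist_0_norm)
  define t where "t = min r s"
  have t: "t > 0" "t \<le> r" "t \<le> s" using \<open>r > 0\<close> s by (auto simp: t_def)
  let ?B = "ball (0::complex) t"
  have "(\<lambda>z. - q2 z / q z) holomorphic_on ?B"
    using t s(2) by (intro holomorphic_intros holomorphic_on_subset[OF q] holomorphic_on_subset[OF q2]) auto
  then obtain P0 where P0: "\<And>z. z \<in> ?B \<Longrightarrow> (P0 has_field_derivative - q2 z / q z) (at z within ?B)"
    by (rule holomorphic_convex_primitive'[OF convex_ball open_ball]) blast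
  \<comment> \<open>Subtracting the constant normalises \<open>P 0 = 0\<close>, which yields
    \<open>u' 0 = 1\<close>.\<close>
  define P where "P z = P0 z - P0 0" for z
  have P: "(P has_field_derivative - q2 z / q z) (at z)" if "z \<in> ?B" for z
    unfolding P_def using P0[OF that] at_within_open[OF that]
    by (auto intro!: derivative_eq_intros)
  define F where "F z = z * exp (P z)" for z
  define F' where "F' z = exp (P z) * (1 - z * q2 z / q z)" for z
  have F: "(F has_field_derivative F' z) (at z)" if "z \<in> ?B" for z
    unfolding F_def F'_def using P[OF that]
    by (auto intro!: derivative_eq_intros simp: algebra_simps)
  \<comment> \<open>Multiplying by \<open>q\<close> clears the denominator in \<open>F'\<close>, and
    \<open>q z - z * q2 z\<close> is the constant \<open>c 1\<close>.\<close>
  have ode: "of_real (\<xi> x) * F' (of_real x) = of_real (c 1) * F (of_real x)" if "\<bar>x\<bar> < t" for x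
  proof -
    let ?x = "of_real x :: complex"
    have "q ?x \<noteq> 0" using s(2) that t by simp
    hence "of_real (\<xi> x) * F' ?x = ?x * exp (P ?x) * (q ?x - ?x * q2 ?x)"
      using \<xi>_eq[of x] that t by (simp add: F'_def field_simps)
    then show ?thesis using q_eq[of ?x] that t by (simp add: F_def)
  qed
  have F'_hol: "F' holomorphic_on ?B"
  proof -
    have "P holomorphic_on ?B"
      unfolding holomorphic_on_open[OF open_ball] using P by blast
    then show ?thesis
      unfolding F'_def using t s(2)
      by (intro holomorphic_intros holomorphic_on_subset[OF q] holomorphic_on_subset[OF q2]) auto
  qed
  define u where "u x = Re (F (of_real x))" for x
  define u' where "u' x = Re (F' (of_real x))" for x
  have du: "(u has_real_derivative u' x) (at x)" if "\<bar>x\<bar> < t" for x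
  proof -
    have "(F has_field_derivative F' (of_real x)) (at (of_real x))"
      using that by (intro F) auto
    hence "((\<lambda>x. F (of_real x)) has_vector_derivative F' (of_real x)) (at x)"
      using has_vector_derivative_real_field by blast
    then show ?thesis
      unfolding u_def u'_def has_real_derivative_iff_has_vector_derivative
      by (rule bounded_linear.has_vector_derivative[OF bounded_linear_Re])
  qed
  have u'0: "u' 0 = 1" by (simp add: u'_def F'_def P_def)
  have "isCont u' 0"
  proof -
    have "isCont F' (of_real 0)"
      using holomorphic_on_imp_continuous_on[OF F'_hol] t by (simp add: continuous_on_eq_continuous_at)
    hence "isCont (\<lambda>x. F' (of_real x)) 0"
      by (rule isCont_o2[OF continuous_of_real[OF continuous_ident]])
    then show ?thesis
      unfolding u'_def by (rule continuous_Re)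
  qed
  then obtain w where w: "w > 0" "\<And>x. \<bar>x\<bar> < w \<Longrightarrow> u' x \<noteq> 0"
    using continuous_at_avoid[of 0 u' 0] u'0 by (metis dist_0_norm real_norm_def zero_neq_one)
  show thesis
  proof (rule that)
    have "F holomorphic_on ball (of_real 0) t"
      unfolding holomorphic_on_open[OF open_ball] of_real_0 using F by blast
    then show "real_analytic_at u 0"
      unfolding u_def using t(1) by (rule real_analytic_at_Re_holomorphic)
    show "u 0 = 0" by (simp add: u_def F_def)
    show "u' 0 = 1" by (rule u'0)
    have "\<xi> x * u' x = c 1 * u x" if "\<bar>x\<bar> < t" for x
      using arg_cong[OF ode[OF that], of Re] by (simp add: u_def u'_def)
    then show "\<forall>\<^sub>F x in nhds 0. (u has_real_derivative u' x) (at x) \<and> u' x \<noteq> 0 \<and> \<xi> x * u' x = c 1 * u x"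
      unfolding eventually_nhds_metric using t w du
      by (intro exI[of _ "min t w"]) (auto simp: dist_norm)
  qed
qed

lemma real_analytic_at_imp_eventually_isCont:
  fixes f :: "'a::euclidean_space \<Rightarrow> real"
  assumes "real_analytic_at f p"
  shows "\<forall>\<^sub>F x in nhds p. isCont f x"
proof -
  obtain f' :: "'a \<Rightarrow> 'a \<Rightarrow>\<^sub>L real" where "\<forall>\<^sub>F x in nhds p. (f has_derivative f' x) (at x)"
    using real_analytic_at_C1[OF assms] by blast
  then show ?thesis by eventually_elim (rule has_derivative_continuous)
qed

text \<open>Joins the linearising coordinate to its analytic inverse. The derivative of the inverse
  is given on a whole neighbourhood, since the web function will be differentiated at all nearby
  points of the new chart.\<close>

lemma linearizing_chart:
  fixes c :: "nat \<Rightarrow> real"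
  assumes "\<forall>\<^sub>F x in nhds 0. (\<lambda>n. c n * x ^ n) sums \<xi> x" and "c 0 = 0" "c 1 \<noteq> 0"
  obtains u u' v where "real_analytic_at u 0" "u 0 = 0" "u' 0 = 1"
    "\<forall>\<^sub>F x in nhds 0. (u has_real_derivative u' x) (at x) \<and> u' x \<noteq> 0 \<and> \<xi> x * u' x = c 1 * u x"
    "real_analytic_at v 0" "v 0 = 0" "isCont v 0" "isCont u 0"
    "\<forall>\<^sub>F x in nhds 0. v (u x) = x" "\<forall>\<^sub>F y in nhds 0. u (v y) = y"
    "\<forall>\<^sub>F y in nhds 0. (v has_real_derivative inverse (u' (v y))) (at y)"
proof -
  obtain u u' where u: "real_analytic_at u 0" "u 0 = 0" "u' 0 = 1"
    "\<forall>\<^sub>F x in nhds 0. (u has_real_derivative u' x) (at x) \<and> u' x \<noteq> 0 \<and> \<xi> x * u' x = c 1 * u x"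
    using real_analytic_linearization[OF assms] by blast
  have du: "(u has_real_derivative u' 0) (at 0)"
    using eventually_nhds_x_imp_x[OF u(4)] by blast
  obtain v where v: "real_analytic_at v 0" "\<forall>\<^sub>F x in nhds 0. v (u x) = x" "\<forall>\<^sub>F y in nhds 0. u (v y) = y"
    using real_analytic_at_inverse_function[OF u(1) du] u by auto
  have v0: "v 0 = 0"
    using eventually_nhds_x_imp_x[OF v(2)] u by simp
  have cont: "\<forall>\<^sub>F y in nhds 0. isCont v y"
    by (rule real_analytic_at_imp_eventually_isCont[OF v(1)])
  have contv: "isCont v 0"
    by (rule eventually_nhds_x_imp_x[OF cont])
  hence lim: "filterlim v (nhds 0) (nhds 0)"
    using v0 tendsto_at_iff_tendsto_nhds[of v 0] by (simp add: isCont_def)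
  \<comment> \<open>Differentiating the inverse at \<open>y\<close> requires the identity on an
    interval around \<open>y\<close>, hence the nested form.\<close>
  have "\<forall>\<^sub>F y in nhds 0. \<forall>\<^sub>F z in nhds y. u (v z) = z"
    using v(3) by (simp add: eventually_eventually)
  moreover note eventually_compose_filterlim[OF u(4) lim] cont
  ultimately have "\<forall>\<^sub>F y in nhds 0. (v has_real_derivative inverse (u' (v y))) (at y)"
  proof eventually_elim
    case (elim y)
    obtain e where "e > 0" "\<And>z. dist z y < e \<Longrightarrow> u (v z) = z"
      using elim(1) unfolding eventually_nhds_metric by blast
    then show ?case
      using elim(2,3)
      by (intro DERIV_inverse_function[where f = u and a = "y - e" and b = "y + e"]) (auto simp: dist_real_def)
  qed
  with that u v v0 contv DERIV_isCont[OF du] show thesis by blast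
qed

subsection \<open>Symmetries vanishing at the origin\<close>

text \<open>The quotient by \<open>t ^ k\<close> is only needed as a continuous function with known
  value at 0: leading terms will be compared by a limit instead of by multivariate
  coefficients.\<close>

lemma powser_order_factor:
  fixes a :: "nat \<Rightarrow> real"
  assumes \<xi>: "\<forall>\<^sub>F t in nhds 0. (\<lambda>n. a n * t ^ n) sums \<xi> t" and a: "\<And>m. m < k \<Longrightarrow> a m = 0"
  obtains \<eta> where "isCont \<eta> 0" "\<eta> 0 = a k" "\<forall>\<^sub>F t in nhds 0. \<xi> t = t ^ k * \<eta> t"
proof -
  obtain r where "r > 0" and r: "\<And>x. \<bar>x\<bar> < r \<Longrightarrow> (\<lambda>n. a n * x ^ n) sums \<xi> x"
    using \<xi> unfolding eventually_nhds_metric dist_real_def by auto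
  have summ: "summable (\<lambda>n. a (n + k) * x ^ n)" if "\<bar>x\<bar> < r" for x
    using r[OF that] summable_powser_ignore_initial_segment[of a k x] by (simp add: sums_iff)
  define \<eta> where "\<eta> t = (\<Sum>n. a (n + k) * t ^ n)" for t
  have "\<xi> t = t ^ k * \<eta> t" if "\<bar>t\<bar> < r" for t
  proof -
    have "\<xi> t = (\<Sum>n. a (n + k) * t ^ (n + k)) + (\<Sum>n<k. a n * t ^ n)"
      using suminf_split_initial_segment[of "\<lambda>n. a n * t ^ n" k] r[OF that] by (simp add: sums_iff)
    also have "(\<Sum>n<k. a n * t ^ n) = 0" using a by simp
    also have "(\<Sum>n. a (n + k) * t ^ (n + k)) = t ^ k * \<eta> t"
      unfolding \<eta>_def suminf_mult[OF summ[OF that], symmetric] by (simp add: power_add mult_ac)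
    finally show ?thesis by simp
  qed
  hence "\<forall>\<^sub>F t in nhds 0. \<xi> t = t ^ k * \<eta> t"
    unfolding eventually_nhds_metric dist_real_def using \<open>r > 0\<close> by auto
  moreover have "isCont \<eta> 0"
    unfolding \<eta>_def using summ[of "r / 2"] \<open>r > 0\<close> by (intro isCont_powser[of _ "r / 2"]) auto
  moreover have "\<eta> 0 = a k"
    unfolding \<eta>_def using powser_zero[of "\<lambda>n. a (n + k)"] by simp
  ultimately show thesis using that by blast
qed

text \<open>The symmetry equation is restricted to the line through \<open>x\<close>, divided by
  \<open>s ^ k\<close>, and \<open>s\<close> is sent to 0. Continuity of \<open>f'\<close> controls
  the left side, and the difference quotient of \<open>f\<close> along the line controls the right
  side.\<close>

lemma leading_coefficients:
  fixes f :: "real ^ 'n \<Rightarrow> real" and f' :: "real ^ 'n \<Rightarrow> (real ^ 'n) \<Rightarrow>\<^sub>L real"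
  assumes f: "\<forall>\<^sub>F x in nhds 0. (f has_derivative f' x) (at x)" "isCont f' 0"
    and \<xi>: "\<And>i. \<forall>\<^sub>F t in nhds 0. (\<lambda>m. a i m * t ^ m) sums \<xi> i t"
    and \<phi>: "\<forall>\<^sub>F t in nhds 0. (\<lambda>m. d m * t ^ m) sums \<phi> (f 0 + t)"
    and eq: "\<forall>\<^sub>F x in nhds 0. f' x (\<chi> i. \<xi> i (x $ i)) = \<phi> (f x)"
    and low: "\<And>i m. m < k \<Longrightarrow> a i m = 0" "\<And>m. m < k \<Longrightarrow> d m = 0"
  shows "f' 0 (\<chi> i. a i k * x $ i ^ k) = d k * f' 0 x ^ k"
proof -
  have "\<exists>\<eta>. isCont \<eta> 0 \<and> \<eta> 0 = a i k \<and> (\<forall>\<^sub>F t in nhds 0. \<xi> i t = t ^ k * \<eta> t)" for i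
    using powser_order_factor[OF \<xi> low(1)] by metis
  then obtain \<eta> where \<eta>: "\<And>i. isCont (\<eta> i) 0" "\<And>i. \<eta> i 0 = a i k"
    "\<And>i. \<forall>\<^sub>F t in nhds 0. \<xi> i t = t ^ k * \<eta> i t"
    by metis
  obtain \<theta> where \<theta>: "isCont \<theta> 0" "\<theta> 0 = d k" "\<forall>\<^sub>F t in nhds 0. \<phi> (f 0 + t) = t ^ k * \<theta> t"
    using powser_order_factor[OF \<phi> low(2)] by metis
  have df: "(f has_derivative f' 0) (at 0)"
    by (rule eventually_nhds_x_imp_x[OF f(1)])
  have line: "filterlim (\<lambda>s. s *\<^sub>R x) (nhds 0) (at (0::real))"
    by (auto intro!: tendsto_eq_intros)
  have flim: "((\<lambda>s. f (s *\<^sub>R x)) \<longlongrightarrow> f 0) (at (0::real))"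
    by (rule isCont_tendsto_compose[OF has_derivative_continuous[OF df] line])
  have quot: "((\<lambda>s. (f (s *\<^sub>R x) - f 0) / s) \<longlongrightarrow> f' 0 x) (at 0)"
  proof -
    have "((\<lambda>s::real. s *\<^sub>R x) has_derivative (\<lambda>s. s *\<^sub>R x)) (at 0)"
      by (auto intro!: derivative_eq_intros)
    moreover have "(f has_derivative f' 0) (at (0 *\<^sub>R x))" using df by simp
    ultimately have "((\<lambda>s. f (s *\<^sub>R x)) has_derivative (\<lambda>s. f' 0 (s *\<^sub>R x))) (at 0)"
      by (rule has_derivative_compose)
    hence "((\<lambda>s. f (s *\<^sub>R x)) has_field_derivative f' 0 x) (at 0)"
      by (simp add: has_field_derivative_def blinfun.scaleR_right mult.commute[of _ "f' 0 x"] mult_commute_abs)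
    then show ?thesis by (simp add: has_field_derivative_iff)
  qed
  have coord: "filterlim (\<lambda>s. s * x $ i) (nhds 0) (at (0::real))" for i
    by (auto intro!: tendsto_eq_intros)
  have "\<forall>\<^sub>F s in at 0. \<forall>i. \<xi> i (s * x $ i) = (s * x $ i) ^ k * \<eta> i (s * x $ i)"
    by (intro eventually_all_finite eventually_compose_filterlim[OF \<eta>(3) coord])
  moreover have "filterlim (\<lambda>s. f (s *\<^sub>R x) - f 0) (nhds 0) (at 0)"
    using tendsto_diff[OF flim tendsto_const, of "f 0"] by simp
  from eventually_compose_filterlim[OF \<theta>(3) this]
  have "\<forall>\<^sub>F s in at 0. \<phi> (f (s *\<^sub>R x)) = (f (s *\<^sub>R x) - f 0) ^ k * \<theta> (f (s *\<^sub>R x) - f 0)"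
    by simp
  moreover note eventually_compose_filterlim[OF eq line]
  moreover have "\<forall>\<^sub>F s in at 0. s \<noteq> (0::real)" by (simp add: eventually_at_filter)
  \<comment> \<open>Both sides carry the factor \<open>s ^ k\<close>, which cancels because the
    filter \<open>at 0\<close> excludes \<open>s = 0\<close>.\<close>
  ultimately have ev: "\<forall>\<^sub>F s in at 0. f' (s *\<^sub>R x) (\<chi> i. x $ i ^ k * \<eta> i (s * x $ i)) =
      ((f (s *\<^sub>R x) - f 0) / s) ^ k * \<theta> (f (s *\<^sub>R x) - f 0)"
  proof eventually_elim
    case (elim s)
    have "(\<chi> i. \<xi> i ((s *\<^sub>R x) $ i)) = s ^ k *\<^sub>R (\<chi> i. x $ i ^ k * \<eta> i (s * x $ i))"
      using elim(1) by (simp add: vec_eq_iff power_mult_distrib)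
    hence "s ^ k * f' (s *\<^sub>R x) (\<chi> i. x $ i ^ k * \<eta> i (s * x $ i)) =
        (f (s *\<^sub>R x) - f 0) ^ k * \<theta> (f (s *\<^sub>R x) - f 0)"
      using elim(2,3) by (simp add: blinfun.scaleR_right)
    then show ?case using elim(4) by (simp add: power_divide field_simps)
  qed
  have "((\<lambda>s. f' (s *\<^sub>R x) (\<chi> i. x $ i ^ k * \<eta> i (s * x $ i))) \<longlongrightarrow> f' 0 (\<chi> i. x $ i ^ k * \<eta> i 0)) (at 0)"
    by (intro tendsto_intros isCont_tendsto_compose[OF f(2) line] isCont_tendsto_compose[OF \<eta>(1) coord])
  from tendsto_cong[THEN iffD1, OF ev this] have "((\<lambda>s. ((f (s *\<^sub>R x) - f 0) / s) ^ k * \<theta> (f (s *\<^sub>R x) - f 0))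
      \<longlongrightarrow> f' 0 (\<chi> i. x $ i ^ k * \<eta> i 0)) (at 0)" .
  moreover have "((\<lambda>s. ((f (s *\<^sub>R x) - f 0) / s) ^ k * \<theta> (f (s *\<^sub>R x) - f 0)) \<longlongrightarrow> f' 0 x ^ k * \<theta> 0) (at 0)"
    using flim by (intro tendsto_intros quot isCont_tendsto_compose[OF \<theta>(1)]) (simp add: LIM_zero)
  ultimately have "f' 0 (\<chi> i. x $ i ^ k * \<eta> i 0) = f' 0 x ^ k * \<theta> 0"
    by (rule tendsto_unique[rotated]) simp
  then show ?thesis by (simp add: \<eta>(2) \<theta>(2) mult.commute)
qed

text \<open>By Euler's relation \<open>H (s *\<^sub>R y) / s\<close> has derivative zero in
  \<open>s\<close>, so it is constant along the ray. Its value at \<open>s = 1\<close> is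
  \<open>H y\<close>, and its limit at 0 is the directional derivative at the origin.\<close>

lemma Euler_homogeneous_imp_linear:
  fixes H :: "'a::real_normed_vector \<Rightarrow> real"
  assumes H: "\<And>y. norm y < r \<Longrightarrow> (H has_derivative H' y) (at y)"
    and hom: "\<And>y. norm y < r \<Longrightarrow> H' y y = H y"
    and y: "norm y < r"
  shows "H y = H' 0 y"
proof -
  have "r > 0" using y norm_ge_zero[of y] by linarith
  have lin: "linear (H' z)" if "norm z < r" for z
    using H[OF that] by (rule has_derivative_linear)
  have small: "norm (s *\<^sub>R y) < r" if "0 \<le> s" "s \<le> 1" for s
    using that y mult_right_mono[of s 1 "norm y"] by auto
  have d: "((\<lambda>s. H (s *\<^sub>R y)) has_real_derivative H' (s *\<^sub>R y) y) (at s)" if "0 \<le> s" "s \<le> 1" for s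
  proof -
    have "((\<lambda>s::real. s *\<^sub>R y) has_derivative (\<lambda>s. s *\<^sub>R y)) (at s)"
      by (auto intro!: derivative_eq_intros)
    from has_derivative_compose[OF this H[OF small[OF that]]]
    show ?thesis
      by (simp add: has_field_derivative_def linear_scale[OF lin[OF small[OF that]]] mult_commute_abs)
  qed
  \<comment> \<open>The parameter 0 is excluded, as the quotient there is just the default value of
    division by zero; it is reached by a one-sided limit below.\<close>
  have "((\<lambda>s. H (s *\<^sub>R y) / s) has_real_derivative 0) (at s within {0<..1})" if "s \<in> {0<..1}" for s
  proof -
    have "H (s *\<^sub>R y) = s * H' (s *\<^sub>R y) y"
      using hom[OF small, of s] that linear_scale[OF lin[OF small], of s s y] by simp
    moreover have "((\<lambda>s. H (s *\<^sub>R y) / s) has_real_derivative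
        (H' (s *\<^sub>R y) y * s - H (s *\<^sub>R y) * 1) / (s * s)) (at s)"
      using that d[of s] by (intro DERIV_divide DERIV_ident) auto
    ultimately show ?thesis
      by (auto intro: has_field_derivative_at_within)
  qed
  from has_field_derivative_zero_constant[OF _ this]
  have "\<exists>c. \<forall>s\<in>{0<..1}. H (s *\<^sub>R y) / s = c" by simp
  then obtain c where c: "\<And>s. s \<in> {0<..1} \<Longrightarrow> H (s *\<^sub>R y) / s = c" by blast
  have "H 0 = 0"
    using hom[of 0] linear_0[OF lin[of 0]] \<open>r > 0\<close> by simp
  hence "((\<lambda>s. H (s *\<^sub>R y) / s) \<longlongrightarrow> H' 0 y) (at 0)"
    using d[of 0] by (simp add: has_field_derivative_iff)
  hence "((\<lambda>s. H (s *\<^sub>R y) / s) \<longlongrightarrow> H' 0 y) (at_right 0)"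
    by (rule filterlim_mono) (auto simp: at_le)
  moreover have "\<forall>\<^sub>F s in at_right 0. c = H (s *\<^sub>R y) / s"
    unfolding eventually_at_right_field using c by (intro exI[of _ 1]) auto
  hence "((\<lambda>s. H (s *\<^sub>R y) / s) \<longlongrightarrow> c) (at_right 0)"
    by (rule Lim_transform_eventually[OF tendsto_const])
  ultimately have "H' 0 y = c"
    by (rule tendsto_unique[OF trivial_limit_at_right_real])
  then show ?thesis using c[of 1] by simp
qed

section \<open>Parallelizing coordinates from a linearizable symmetry\<close>

lemma real_analytic_at_vec:
  fixes h :: "'n::finite \<Rightarrow> real \<Rightarrow> real"
  assumes "\<And>i. real_analytic_at (h i) (p $ i)"
  shows "real_analytic_at (\<lambda>x :: real ^ 'n. \<chi> i. h i (x $ i)) p"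
proof -
  have "real_analytic_at (\<lambda>x. \<Sum>i\<in>UNIV. h i (x \<bullet> axis i 1) *\<^sub>R (axis i 1 :: real ^ 'n)) p"
  proof (intro real_analytic_at_sum real_analytic_at_bounded_linear[OF bounded_linear_scaleR_left])
    show "real_analytic_at (\<lambda>x. h i (x \<bullet> axis i 1)) p" for i
      using assms by (intro real_analytic_at_inner_Basis) (simp_all add: inner_axis axis_in_Basis_iff)
  qed
  moreover have "(\<lambda>x. \<Sum>i\<in>UNIV. h i (x \<bullet> axis i 1) *\<^sub>R (axis i 1 :: real ^ 'n)) = (\<lambda>x. \<chi> i. h i (x $ i))"
    by (simp add: fun_eq_iff vec_eq_iff inner_axis) (simp add: axis_def if_distrib cong: if_cong)
  ultimately show ?thesis by simp
qed

text \<open>The submersion condition on \<open>v\<close> is inherited from \<open>u\<close>, because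
  it speaks only of leaf tangents.\<close>

lemma first_integral_ofI:
  assumes "analytic_submersion u" "real_analytic_at v 0"
    and "\<forall>\<^sub>F x in nhds 0. leaf_tangent v x = leaf_tangent u x"
  shows "first_integral_of u v"
  using assms eventually_elim2[of "\<lambda>x. leaf_tangent u x \<noteq> UNIV" "nhds 0" "\<lambda>x. leaf_tangent v x = leaf_tangent u x"
      "\<lambda>x. leaf_tangent v x \<noteq> UNIV"]
  by (auto simp: first_integral_of_def analytic_submersion_def)

lemma leaf_tangent_eq:
  assumes "(u has_derivative u') (at x)"
  shows "leaf_tangent u x = {w. u' w = 0}"
  unfolding leaf_tangent_def frechet_derivative_at[OF assms, symmetric] ..

text \<open>In the linearising charts of the \<xi> i the field becomes \<open>d 1\<close> times the
  Euler field, because all linear coefficients coincide; in the linearising coordinate of \<phi> the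
  function \<open>f\<close> then satisfies Euler's relation. It is therefore linear, while the
  coordinate foliations keep linear first integrals.\<close>

lemma parallelizable_if_linearizable_field:
  fixes f :: "real ^ 'n \<Rightarrow> real" and f' :: "real ^ 'n \<Rightarrow> (real ^ 'n) \<Rightarrow>\<^sub>L real"
  assumes sub: "\<And>j. analytic_submersion (coordinate_web f j)"
    and f: "\<forall>\<^sub>F x in nhds 0. (f has_derivative f' x) (at x)"
    and \<xi>: "\<And>i. \<forall>\<^sub>F t in nhds 0. (\<lambda>m. a i m * t ^ m) sums \<xi> i t"
    and \<phi>: "\<forall>\<^sub>F t in nhds 0. (\<lambda>m. d m * t ^ m) sums \<phi> (f 0 + t)"
    and eq: "\<forall>\<^sub>F x in nhds 0. f' x (\<chi> i. \<xi> i (x $ i)) = \<phi> (f x)"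
    and a: "\<And>i. a i 0 = 0" "\<And>i. a i 1 = d 1" and d: "d 0 = 0" "d 1 \<noteq> 0"
  shows "parallelizable (coordinate_web f)"
proof -
  \<comment> \<open>Bundling the properties of a chart into one predicate allows charts to be chosen
    for all \<open>i\<close> at once.\<close>
  define chart where "chart i u u' v \<longleftrightarrow> real_analytic_at u 0 \<and> u 0 = 0 \<and> u' 0 = 1 \<and>
    (\<forall>\<^sub>F x in nhds 0. (u has_real_derivative u' x) (at x) \<and> u' x \<noteq> 0 \<and> \<xi> i x * u' x = d 1 * u x) \<and>
    real_analytic_at v 0 \<and> v 0 = 0 \<and> isCont v 0 \<and> isCont u 0 \<and>
    (\<forall>\<^sub>F x in nhds 0. v (u x) = x) \<and> (\<forall>\<^sub>F y in nhds 0. u (v y) = y) \<and>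
    (\<forall>\<^sub>F y in nhds 0. (v has_real_derivative inverse (u' (v y))) (at y))" for i u u' v
  have "\<exists>u u' v. chart i u u' v" for i
  proof -
    have "a i 1 \<noteq> 0" using a d by simp
    then show ?thesis
      unfolding chart_def
      by (rule linearizing_chart[OF \<xi>[of i] a(1)], unfold a(2)) (intro exI conjI, assumption+)
  qed
  then obtain u u' v where C: "\<And>i. chart i (u i) (u' i) (v i)" by metis
  have u: "real_analytic_at (u i) 0" "u i 0 = 0" "u' i 0 = 1"
      "\<forall>\<^sub>F x in nhds 0. (u i has_real_derivative u' i x) (at x) \<and> u' i x \<noteq> 0 \<and> \<xi> i x * u' i x = d 1 * u i x"
    and v: "real_analytic_at (v i) 0" "v i 0 = 0" "isCont (v i) 0" "isCont (u i) 0"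
      "\<forall>\<^sub>F x in nhds 0. v i (u i x) = x" "\<forall>\<^sub>F y in nhds 0. u i (v i y) = y"
      "\<forall>\<^sub>F y in nhds 0. (v i has_real_derivative inverse (u' i (v i y))) (at y)" for i
    using C[of i] unfolding chart_def by blast+
  \<comment> \<open>The coordinate on the target is centred at \<open>f 0\<close>. Since
    \<open>U'\<close> does not vanish, composing with \<open>U\<close> leaves the leaf tangents of
    \<open>f\<close> unchanged.\<close>
  obtain U U' where U: "U' 0 = (1::real)"
    "\<forall>\<^sub>F t in nhds 0. (U has_real_derivative U' t) (at t) \<and> U' t \<noteq> 0 \<and> \<phi> (f 0 + t) * U' t = d 1 * U t"
    using real_analytic_linearization[OF \<phi> d] by blast
  define \<Phi> :: "real ^ 'n \<Rightarrow> real ^ 'n" where "\<Phi> x = (\<chi> i. u i (x $ i))" for x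
  define \<Psi> :: "real ^ 'n \<Rightarrow> real ^ 'n" where "\<Psi> y = (\<chi> i. v i (y $ i))" for y
  have [simp]: "\<Phi> 0 = 0" "\<Psi> 0 = 0"
    using u(2) v(2) by (simp_all add: \<Phi>_def \<Psi>_def vec_eq_iff)
  have coord: "filterlim (\<lambda>x :: real ^ 'n. x $ i) (nhds 0) (nhds 0)" for i
    by (auto intro!: tendsto_eq_intros filterlim_ident)
  have lim_nhds: "filterlim g (nhds (g p)) (nhds p)" if "isCont g p"
    for g :: "'b::t2_space \<Rightarrow> 'c::topological_space" and p
    using that tendsto_at_iff_tendsto_nhds[of g p] by (simp add: isCont_def)
  have \<Phi>lim: "filterlim \<Phi> (nhds 0) (nhds 0)"
  proof -
    have "filterlim \<Phi> (nhds (\<chi> i. u i 0)) (nhds 0)"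
      unfolding \<Phi>_def using lim_nhds[OF v(4)] u(2)
      by (intro tendsto_vec_lambda) (auto intro: filterlim_compose[OF _ coord])
    then show ?thesis using u(2) by (simp add: zero_vec_def)
  qed
  have \<Psi>lim: "filterlim \<Psi> (nhds 0) (nhds 0)"
  proof -
    have "filterlim \<Psi> (nhds (\<chi> i. v i 0)) (nhds 0)"
      unfolding \<Psi>_def using lim_nhds[OF v(3)] v(2)
      by (intro tendsto_vec_lambda) (auto intro: filterlim_compose[OF _ coord])
    then show ?thesis using v(2) by (simp add: zero_vec_def)
  qed
  have \<Phi>\<Psi>: "\<forall>\<^sub>F y in nhds 0. \<Phi> (\<Psi> y) = y"
    unfolding \<Phi>_def \<Psi>_def vec_eq_iff vec_lambda_beta
    by (intro eventually_all_finite eventually_compose_filterlim[OF v(6) coord])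
  have \<Psi>\<Phi>: "\<forall>\<^sub>F x in nhds 0. \<Psi> (\<Phi> x) = x"
    unfolding \<Phi>_def \<Psi>_def vec_eq_iff vec_lambda_beta
    by (intro eventually_all_finite eventually_compose_filterlim[OF v(5) coord])
  have \<Phi>an: "real_analytic_at \<Phi> 0"
    unfolding \<Phi>_def using u(1) by (intro real_analytic_at_vec) simp
  have \<Psi>an: "real_analytic_at \<Psi> 0"
    unfolding \<Psi>_def using v(1) by (intro real_analytic_at_vec) simp
  have chart: "local_coordinates \<Phi>"
    unfolding local_coordinates_def using \<Phi>an \<Psi>an \<Phi>\<Psi> \<Psi>\<Phi> by auto
  have "isCont f 0"
    using eventually_nhds_x_imp_x[OF f] by (rule has_derivative_continuous)
  from tendsto_diff[OF lim_nhds[OF this] tendsto_const, of "f 0"]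
  have flim: "filterlim (\<lambda>x. f x - f 0) (nhds 0) (nhds 0)" by simp
  have Uf: "\<forall>\<^sub>F x in nhds 0. (U has_real_derivative U' (f x - f 0)) (at (f x - f 0)) \<and>
      U' (f x - f 0) \<noteq> 0 \<and> \<phi> (f x) * U' (f x - f 0) = d 1 * U (f x - f 0)"
    using eventually_compose_filterlim[OF U(2) flim] by simp
  have dUf: "\<forall>\<^sub>F x in nhds 0. ((\<lambda>x. U (f x - f 0)) has_derivative (\<lambda>w. U' (f x - f 0) * f' x w)) (at x)"
    using f Uf
  proof eventually_elim
    case (elim x)
    have "((\<lambda>x. f x - f 0) has_derivative f' x) (at x)"
      using elim(1) by (auto intro!: derivative_eq_intros)
    moreover have "(U has_derivative (*) (U' (f x - f 0))) (at (f x - f 0))"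
      using elim(2) by (simp add: has_field_derivative_def)
    ultimately show ?case by (rule has_derivative_compose)
  qed
  \<comment> \<open>\<open>H\<close> is \<open>f\<close> read in the new source and target
    coordinates; \<open>V y\<close> will be the differential of \<Psi> at \<open>y\<close>.\<close>
  define H where "H y = U (f (\<Psi> y) - f 0)" for y
  define V where "V y h = (\<chi> i. inverse (u' i (v i (y $ i))) * h $ i)" for y h :: "real ^ 'n"
  define H' where "H' y h = U' (f (\<Psi> y) - f 0) * f' (\<Psi> y) (V y h)" for y h
  have "\<forall>\<^sub>F y in nhds 0. \<forall>i. (v i has_real_derivative inverse (u' i (v i (y $ i)))) (at (y $ i))"
    by (intro eventually_all_finite eventually_compose_filterlim[OF v(7) coord])
  hence d\<Psi>: "\<forall>\<^sub>F y in nhds 0. (\<Psi> has_derivative V y) (at y)"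
  proof eventually_elim
    case (elim y)
    have "((\<lambda>y. v i (y $ i)) has_derivative (\<lambda>h. inverse (u' i (v i (y $ i))) * h $ i)) (at y)" for i
      using elim has_derivative_compose[of "\<lambda>y. y $ i" "\<lambda>h. h $ i" y UNIV "v i" "(*) (inverse (u' i (v i (y $ i))))"]
      by (simp add: has_field_derivative_def bounded_linear_imp_has_derivative bounded_linear_vec_nth)
    then show ?case
      unfolding \<Psi>_def V_def
      by (intro has_derivative_componentwise_within[THEN iffD2]) (auto simp: Basis_vec_def inner_axis)
  qed
  have "\<forall>\<^sub>F y in nhds 0. (H has_derivative H' y) (at y)"
    using d\<Psi> eventually_compose_filterlim[OF dUf \<Psi>lim]
    unfolding H_def H'_def by eventually_elim (rule has_derivative_compose)
  moreover have "\<forall>\<^sub>F y in nhds 0. H' y y = H y"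
  proof -
    have "\<forall>\<^sub>F x in nhds 0. u' i (x $ i) \<noteq> 0 \<and> \<xi> i (x $ i) * u' i (x $ i) = d 1 * u i (x $ i)" for i
      using eventually_compose_filterlim[OF u(4)[of i] coord[of i]] by (rule eventually_mono) blast
    hence "\<forall>\<^sub>F x in nhds 0. \<forall>i. u' i (x $ i) \<noteq> 0 \<and> \<xi> i (x $ i) * u' i (x $ i) = d 1 * u i (x $ i)"
      by (rule eventually_all_finite)
    from eventually_compose_filterlim[OF this \<Psi>lim]
      eventually_compose_filterlim[OF eq \<Psi>lim] eventually_compose_filterlim[OF Uf \<Psi>lim] \<Phi>\<Psi>
    show ?thesis
    proof eventually_elim
      case (elim y)
      \<comment> \<open>The Euler field is pushed forward by \<Psi>: the linearisation identity
        reads \<open>\<xi> i x = d 1 * u i x / u' i x\<close>, and \<open>u i\<close> takes the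
        value \<open>y $ i\<close> at the point considered.\<close>
      have "d 1 *\<^sub>R V y y = (\<chi> i. \<xi> i (\<Psi> y $ i))"
      proof (unfold vec_eq_iff, rule allI)
        fix i
        have "u i (\<Psi> y $ i) = y $ i"
          using elim(4) by (metis \<Phi>_def vec_lambda_beta)
        then show "(d 1 *\<^sub>R V y y) $ i = (\<chi> i. \<xi> i (\<Psi> y $ i)) $ i"
          using elim(1)[rule_format, of i] by (simp add: V_def \<Psi>_def field_simps)
      qed
      hence "d 1 * f' (\<Psi> y) (V y y) = \<phi> (f (\<Psi> y))"
        using elim(2) blinfun.scaleR_right[of "f' (\<Psi> y)" "d 1" "V y y"] by simp
      hence "d 1 * H' y y = \<phi> (f (\<Psi> y)) * U' (f (\<Psi> y) - f 0)"
        unfolding H'_def by (metis mult.assoc mult.commute)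
      also have "\<dots> = d 1 * H y"
        using elim(3) by (simp add: H_def)
      finally have "d 1 * H' y y = d 1 * H y" .
      then show ?case using d by simp
    qed
  qed
  ultimately have "\<forall>\<^sub>F y in nhds 0. (H has_derivative H' y) (at y) \<and> H' y y = H y"
    by (rule eventually_conj)
  then obtain r where "r > 0" and r: "\<And>y. norm y < r \<Longrightarrow> (H has_derivative H' y) (at y) \<and> H' y y = H y"
    unfolding eventually_nhds_metric dist_0_norm by (auto simp: dist_norm)
  have "H y = f' 0 y" if "norm y < r" for y
  proof -
    \<comment> \<open>All coordinate changes have derivative 1 at the origin, so the linear form
      obtained is the differential of \<open>f\<close> itself.\<close>
    have "H' 0 y = f' 0 y"
      by (simp add: H'_def V_def U(1) u(3) v(2))
    with Euler_homogeneous_imp_linear[of r H H' y] r that show ?thesis by auto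
  qed
  hence "\<forall>\<^sub>F y in nhds 0. H y = f' 0 y"
    unfolding eventually_nhds_metric using \<open>r > 0\<close> by (auto simp: dist_norm)
  from eventually_compose_filterlim[OF this \<Phi>lim] \<Psi>\<Phi>
  have "\<forall>\<^sub>F x in nhds 0. f' 0 (\<Phi> x) = U (f x - f 0)"
    by eventually_elim (simp add: H_def)
  \<comment> \<open>Transferring a derivative at \<open>x\<close> needs equality on a neighbourhood
    of \<open>x\<close>, not only at \<open>x\<close>.\<close>
  hence "\<forall>\<^sub>F x in nhds 0. \<forall>\<^sub>F z in nhds x. U (f z - f 0) = f' 0 (\<Phi> z)"
    by (simp add: eventually_eventually eq_commute)
  with dUf f Uf have leaf: "\<forall>\<^sub>F x in nhds 0. leaf_tangent (f' 0 \<circ> \<Phi>) x = leaf_tangent f x"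
  proof eventually_elim
    case (elim x)
    have "((f' 0 \<circ> \<Phi>) has_derivative (\<lambda>w. U' (f x - f 0) * f' x w)) (at x)"
      using elim(1) eventually_nhds_x_imp_x[OF elim(4)] elim(4)
      by (intro has_derivative_transform_eventually[OF elim(1)])
         (auto simp: eventually_at_filter elim: eventually_mono)
    from leaf_tangent_eq[OF this] leaf_tangent_eq[OF elim(2)] elim(3)
    show ?case by auto
  qed
  have "\<exists>l. linear l \<and> first_integral_of (coordinate_web f j) (l \<circ> \<Phi>)" for j
  proof (cases j)
    case None
    have "first_integral_of (coordinate_web f j) (f' 0 \<circ> \<Phi>)"
    proof (rule first_integral_ofI[OF sub])
      show "real_analytic_at (f' 0 \<circ> \<Phi>) 0"
        unfolding o_def by (rule real_analytic_at_bounded_linear[OF blinfun.bounded_linear_right \<Phi>an])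
    qed (use leaf None in \<open>simp add: coordinate_web_def\<close>)
    then show ?thesis
      using bounded_linear.linear[OF blinfun.bounded_linear_right] by blast
  next
    case (Some i)
    have "first_integral_of (coordinate_web f j) ((\<lambda>y. y $ i) \<circ> \<Phi>)"
    proof (rule first_integral_ofI[OF sub])
      show "real_analytic_at ((\<lambda>y. y $ i) \<circ> \<Phi>) 0"
        unfolding o_def by (rule real_analytic_at_bounded_linear[OF bounded_linear_vec_nth \<Phi>an])
      from eventually_compose_filterlim[OF u(4)[of i] coord[of i]]
      show "\<forall>\<^sub>F x in nhds 0. leaf_tangent ((\<lambda>y. y $ i) \<circ> \<Phi>) x = leaf_tangent (coordinate_web f j) x"
      proof eventually_elim
        case (elim x)
        have nth: "((\<lambda>y. y $ i) has_derivative (\<lambda>h. h $ i)) (at x)"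
          by (intro bounded_linear_imp_has_derivative bounded_linear_vec_nth)
        have "((\<lambda>x. u i (x $ i)) has_derivative (\<lambda>h. u' i (x $ i) * h $ i)) (at x)"
          using elim by (intro has_derivative_compose[OF nth]) (simp add: has_field_derivative_def)
        hence "((\<lambda>y. y $ i) \<circ> \<Phi> has_derivative (\<lambda>h. u' i (x $ i) * h $ i)) (at x)"
          by (simp add: o_def \<Phi>_def)
        from leaf_tangent_eq[OF this] leaf_tangent_eq[OF nth] elim Some
        show ?case by (auto simp: coordinate_web_def)
      qed
    qed
    then show ?thesis
      using bounded_linear.linear[OF bounded_linear_vec_nth] by blast
  qed
  with chart show ?thesis
    unfolding parallelizable_def by blast
qed

section \<open>Dimension one, and triviality of the isotropy in general\<close>

lemma real_analytic_at_ident: "real_analytic_at (\<lambda>x::real. x) p"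
  using real_analytic_at_Re_holomorphic[of "\<lambda>z. z" p 1] by (simp add: holomorphic_on_ident)

text \<open>In dimension 1 transversality applies to single foliations, so all leaf tangents are
  zero. One coordinate function in the identity chart thus serves as a first integral for every
  foliation.\<close>

lemma parallelizable_dim_1:
  fixes f :: "real ^ 'n \<Rightarrow> real"
  assumes web: "web (coordinate_web f)" and n: "CARD('n) = 1"
  shows "parallelizable (coordinate_web f)"
proof -
  obtain i :: 'n where "True" by simp
  have an: "real_analytic_at (\<lambda>x :: real ^ 'n. x) 0"
    using real_analytic_at_vec[of "\<lambda>_ t. t" "0 :: real ^ 'n"] by (simp add: real_analytic_at_ident)
  have chart: "local_coordinates (\<lambda>x :: real ^ 'n. x)"
    unfolding local_coordinates_def using an by (intro conjI exI[of _ "\<lambda>x. x"]) auto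
  have "first_integral_of (coordinate_web f j) ((\<lambda>y. y $ i) \<circ> (\<lambda>x. x))" for j
  proof (rule first_integral_ofI)
    show "analytic_submersion (coordinate_web f j)"
      using web by (simp add: web_def)
    show "real_analytic_at ((\<lambda>y :: real ^ 'n. y $ i) \<circ> (\<lambda>x. x)) 0"
      using real_analytic_at_bounded_linear[OF bounded_linear_vec_nth[of i] an] by (simp add: o_def)
    have "\<forall>\<^sub>F x in nhds 0. \<forall>J. card J = CARD('n) \<longrightarrow> (\<Inter>j\<in>J. leaf_tangent (coordinate_web f j) x) = {0}"
      using web by (simp add: web_def)
    then show "\<forall>\<^sub>F x in nhds 0. leaf_tangent ((\<lambda>y. y $ i) \<circ> (\<lambda>x. x)) x = leaf_tangent (coordinate_web f j) x"
    proof eventually_elim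
      case (elim x)
      have "leaf_tangent (coordinate_web f k) x = {0}" for k
        using elim[rule_format, of "{k}"] n by simp
      from this[of j] this[of "Some i"] show ?case
        by (simp add: o_def coordinate_web_def)
    qed
  qed
  moreover have "linear (\<lambda>y :: real ^ 'n. y $ i)"
    by (rule bounded_linear.linear[OF bounded_linear_vec_nth])
  ultimately show ?thesis
    unfolding parallelizable_def using chart by blast
qed

text \<open>This is the kernel form of the injectivity of evaluation at the origin. Axis directions
  express every \<open>a i k\<close> through \<open>d k\<close>, and one mixed direction then kills
  \<open>d k\<close> for \<open>k \<ge> 2\<close>.\<close>

lemma isotropy_trivial:
  fixes f :: "real ^ 'n \<Rightarrow> real"
  assumes web: "web (coordinate_web f)" and np: "\<not> parallelizable (coordinate_web f)"
    and X: "infinitesimal_isomorphism f X" and X0: "X 0 = 0"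
  shows "\<forall>\<^sub>F x in nhds 0. X x = 0"
proof -
  have sub: "analytic_submersion (coordinate_web f j)" for j
    using web by (simp add: web_def)
  from sub[of None] have "real_analytic_at f 0"
    by (simp add: analytic_submersion_def coordinate_web_def)
  then obtain f' :: "real ^ 'n \<Rightarrow> (real ^ 'n) \<Rightarrow>\<^sub>L real" where
    f: "\<forall>\<^sub>F x in nhds 0. (f has_derivative f' x) (at x)" "isCont f' 0"
    by (rule real_analytic_at_C1)
  define c where "c i = f' 0 (axis i 1)" for i
  have c: "c i \<noteq> 0" for i
  \<comment> \<open>If \<open>c i\<close> vanished, \<open>axis i 1\<close> would be tangent to the
    leaves of \<open>f\<close> and of all coordinates but the \<open>i\<close>-th. These are
    \<open>n\<close> foliations of the web, contradicting transversality.\<close>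
  proof
    assume "c i = 0"
    hence "axis i 1 \<in> leaf_tangent f 0"
      using leaf_tangent_eq[OF eventually_nhds_x_imp_x[OF f(1)]] by (simp add: c_def)
    moreover have "axis i 1 \<in> leaf_tangent (\<lambda>x. x $ j) 0" if "j \<noteq> i" for j
    proof -
      have "((\<lambda>x :: real ^ 'n. x $ j) has_derivative (\<lambda>h. h $ j)) (at 0)"
        by (intro bounded_linear_imp_has_derivative bounded_linear_vec_nth)
      from leaf_tangent_eq[OF this] that show ?thesis by (simp add: axis_def)
    qed
    ultimately have "axis i 1 \<in> (\<Inter>j\<in>UNIV - {Some i}. leaf_tangent (coordinate_web f j) 0)"
      by (auto simp: coordinate_web_def split: option.split)
    moreover have "card (UNIV - {Some i}) = CARD('n)"
      by (simp add: card_Diff_singleton)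
    hence "(\<Inter>j\<in>UNIV - {Some i}. leaf_tangent (coordinate_web f j) 0) = {0}"
      using web eventually_nhds_x_imp_x unfolding web_def by blast
    ultimately show False by (simp add: axis_eq_0_iff)
  qed
  obtain \<xi> \<phi> where \<xi>: "\<And>i. real_analytic_at (\<xi> i) (0::real)" and \<phi>: "real_analytic_at \<phi> (f 0)"
    and X\<xi>: "\<forall>\<^sub>F x in nhds 0. X x = (\<chi> i. \<xi> i (x $ i))"
    and X\<phi>: "\<forall>\<^sub>F x in nhds 0. frechet_derivative f (at x) (X x) = \<phi> (f x)"
    using X unfolding infinitesimal_isomorphism_def by blast
  have "\<forall>i. \<exists>a. \<forall>\<^sub>F t in nhds 0. (\<lambda>m. a m * t ^ m) sums \<xi> i t"
    using \<xi> by (simp add: real_analytic_at_real_iff_sums)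
  then obtain a where a: "\<And>i. \<forall>\<^sub>F t in nhds 0. (\<lambda>m. a i m * t ^ m) sums \<xi> i t"
    by metis
  obtain d where "\<forall>\<^sub>F t in nhds (f 0). (\<lambda>m. d m * (t - f 0) ^ m) sums \<phi> t"
    using \<phi> by (auto simp: real_analytic_at_real_iff_sums)
  moreover have "filterlim (\<lambda>t. f 0 + t) (nhds (f 0)) (nhds 0)"
    by (auto intro!: tendsto_eq_intros filterlim_ident)
  ultimately have "\<forall>\<^sub>F t in nhds 0. (\<lambda>m. d m * (f 0 + t - f 0) ^ m) sums \<phi> (f 0 + t)"
    by (rule eventually_compose_filterlim)
  hence d: "\<forall>\<^sub>F t in nhds 0. (\<lambda>m. d m * t ^ m) sums \<phi> (f 0 + t)" by simp
  have eq: "\<forall>\<^sub>F x in nhds 0. f' x (\<chi> i. \<xi> i (x $ i)) = \<phi> (f x)"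
    using f(1) X\<xi> X\<phi>
  proof eventually_elim
    case (elim x)
    then show ?case using frechet_derivative_at[OF elim(1)] by simp
  qed
  have \<xi>0: "\<xi> i 0 = 0" for i
    using eventually_nhds_x_imp_x[OF X\<xi>] X0 by (simp add: vec_eq_iff)
  have a0: "a i 0 = 0" for i
    using eventually_nhds_x_imp_x[OF a[of i]] \<xi>0[of i] powser_sums_zero_iff by fastforce
  have "\<phi> (f 0) = 0"
    using eventually_nhds_x_imp_x[OF eq] \<xi>0 by (simp flip: zero_vec_def)
  hence d0: "d 0 = 0"
    using eventually_nhds_x_imp_x[OF d] powser_sums_zero_iff by fastforce
  note lead = leading_coefficients[OF f a d eq]
  \<comment> \<open>Testing on \<open>axis i 1\<close> isolates one coefficient. The bound
    \<open>k \<ge> 1\<close> makes the other components vanish and the subtraction in the exponent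
    genuine.\<close>
  have diag: "a i k = d k * c i ^ (k - 1)"
    if "k \<ge> 1" "\<And>i m. m < k \<Longrightarrow> a i m = 0" "\<And>m. m < k \<Longrightarrow> d m = 0" for i k
  proof -
    have "(\<chi> j. a j k * axis i 1 $ j ^ k) = a i k *\<^sub>R axis i 1"
      using that(1) by (simp add: vec_eq_iff axis_def)
    with lead[where k = k and x = "axis i 1", OF that(2,3)] have "a i k * c i = d k * c i ^ k"
      by (simp add: blinfun.scaleR_right c_def)
    also have "\<dots> = d k * c i ^ (k - 1) * c i"
      using that(1) by (cases k) auto
    finally show ?thesis using c by simp
  qed
  have a1: "a i 1 = d 1" for i
    using diag[of 1 i] a0 d0 by simp
  \<comment> \<open>Here non-parallelizability enters: otherwise the field could be
    linearised.\<close>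
  have d1: "d 1 = 0"
    using parallelizable_if_linearizable_field[OF sub f(1) a d eq a0 a1 d0] np by blast
  have "CARD('n) \<noteq> 1"
    using parallelizable_dim_1[OF web] np by blast
  then obtain p q :: 'n where pq: "p \<noteq> q"
    by (metis (full_types) UNIV_eq_I card_1_singleton_iff insertI1 singletonD One_nat_def singletonI)
  have all0: "d k = 0 \<and> (\<forall>i. a i k = 0)" for k
  proof (induction k rule: less_induct)
    case (less k)
    have low: "\<And>i m. m < k \<Longrightarrow> a i m = 0" "\<And>m. m < k \<Longrightarrow> d m = 0"
      using less by blast+
    consider "k = 0" | "k = 1" | "k \<ge> 2" by linarith
    then show ?case
    proof cases
      case 3
      \<comment> \<open>The direction is scaled so that each of its two components contributes 1 to
        \<open>f' 0 ?x\<close>. The leading-term identity becomes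
        \<open>2 * d k = 2 ^ k * d k\<close>, and \<open>2 ^ k\<close> differs from 2 for
        \<open>k \<ge> 2\<close>.\<close>
      let ?x = "axis p (1 / c p) + axis q (1 / c q)"
      have ax: "axis i t = t *\<^sub>R (axis i 1 :: real ^ 'n)" for i t
        by (simp add: vec_eq_iff axis_def)
      have summand: "a i k / c i ^ k * c i = d k" for i
        using diag[where i = i and k = k, OF _ low] 3 c[of i] by (cases k) auto
      have "(\<chi> i. a i k * ?x $ i ^ k) = (a p k / c p ^ k) *\<^sub>R axis p 1 + (a q k / c q ^ k) *\<^sub>R axis q 1"
        using pq 3 by (auto simp: vec_eq_iff axis_def power_divide)
      hence "f' 0 (\<chi> i. a i k * ?x $ i ^ k) = d k + d k"
        using summand[of p] summand[of q] by (simp add: blinfun.add_right blinfun.scaleR_right c_def)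
      moreover have "f' 0 ?x = 2"
        using c[of p] c[of q] unfolding ax[of p "1 / c p"] ax[of q "1 / c q"]
        by (simp add: blinfun.add_right blinfun.scaleR_right c_def)
      ultimately have "d k + d k = d k * 2 ^ k"
        using lead[where k = k and x = ?x, OF low] by simp
      moreover have "(2::real) ^ k \<noteq> 2"
        using power_strict_increasing[of 1 k "2::real"] 3 by simp
      ultimately have "d k = 0" by (simp flip: mult_2_right)
      then show ?thesis using diag[where k = k, OF _ low] 3 by simp
    qed (use a0 d0 a1 d1 in auto)
  qed
  have "\<forall>\<^sub>F t in nhds 0. \<xi> i t = 0" for i
    using a[of i]
  proof eventually_elim
    case (elim t)
    then show ?case using all0 by (auto simp: sums_iff)
  qed
  moreover have "filterlim (\<lambda>x :: real ^ 'n. x $ i) (nhds 0) (nhds 0)" for i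
    by (auto intro!: tendsto_eq_intros filterlim_ident)
  ultimately have "\<forall>\<^sub>F x in nhds 0. \<forall>i. \<xi> i ((x :: real ^ 'n) $ i) = 0"
    by (intro eventually_all_finite) (rule eventually_compose_filterlim)
  with X\<xi> show ?thesis
    by eventually_elim (simp add: zero_vec_def)
qed

subsection \<open>The algebra of infinitesimal isomorphisms\<close>

text \<open>The filter \<open>nhds 0\<close>, unlike \<open>at 0\<close>, sees the origin itself, so
  the value there depends only on the germ.\<close>

lift_definition germ_value :: "'n::finite vector_field_germ \<Rightarrow> real ^ 'n" is "\<lambda>X. X 0"
  by (rule eventually_nhds_x_imp_x)

lemma linear_germ_value: "linear germ_value"
  by (rule linearI; transfer) simp_all

text \<open>The subspace property reduces injectivity of evaluation to its kernel and identifies the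
  span of a basis with the algebra.\<close>

lemma subspace_isomorphism_algebra:
  fixes f :: "real ^ 'n \<Rightarrow> real"
  assumes "real_analytic_at f 0"
  shows "subspace (isomorphism_algebra f)"
proof -
  obtain f' :: "real ^ 'n \<Rightarrow> (real ^ 'n) \<Rightarrow>\<^sub>L real" where
    f: "\<forall>\<^sub>F x in nhds 0. (f has_derivative f' x) (at x)"
    using real_analytic_at_C1[OF assms] by blast
  \<comment> \<open>Linearity of \<open>frechet_derivative\<close> is available only where
    \<open>f\<close> is differentiable, hence only near the origin.\<close>
  have lin: "\<forall>\<^sub>F x in nhds 0. linear (frechet_derivative f (at x))"
    using f by eventually_elim (auto intro: linear_frechet_derivative differentiableI)
  show ?thesis
    unfolding isomorphism_algebra_def
  proof (rule subspaceI)
    have "infinitesimal_isomorphism f (\<lambda>_. 0)"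
      unfolding infinitesimal_isomorphism_def
    proof (intro exI[of _ "\<lambda>_ _. 0"] exI[of _ "\<lambda>_. 0"] conjI)
      show "\<forall>\<^sub>F x in nhds 0. frechet_derivative f (at x) 0 = 0"
        using lin by eventually_elim (rule linear_0)
    qed (auto simp: real_analytic_at_zero vec_eq_iff)
    then show "0 \<in> {germ X |X. infinitesimal_isomorphism f X}"
      by (auto simp: zero_vector_field_germ_def)
  next
    fix x y assume "x \<in> {germ X |X. infinitesimal_isomorphism f X}" "y \<in> {germ X |X. infinitesimal_isomorphism f X}"
    then obtain X Y where X: "x = germ X" "infinitesimal_isomorphism f X"
      and Y: "y = germ Y" "infinitesimal_isomorphism f Y" by blast
    obtain \<xi> \<phi> where \<xi>: "\<And>i. real_analytic_at (\<xi> i) (0::real)" "real_analytic_at \<phi> (f 0)"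
      "\<forall>\<^sub>F x in nhds 0. X x = (\<chi> i. \<xi> i (x $ i))"
      "\<forall>\<^sub>F x in nhds 0. frechet_derivative f (at x) (X x) = \<phi> (f x)"
      using X(2) unfolding infinitesimal_isomorphism_def by blast
    obtain \<zeta> \<psi> where \<zeta>: "\<And>i. real_analytic_at (\<zeta> i) (0::real)" "real_analytic_at \<psi> (f 0)"
      "\<forall>\<^sub>F x in nhds 0. Y x = (\<chi> i. \<zeta> i (x $ i))"
      "\<forall>\<^sub>F x in nhds 0. frechet_derivative f (at x) (Y x) = \<psi> (f x)"
      using Y(2) unfolding infinitesimal_isomorphism_def by blast
    have "infinitesimal_isomorphism f (\<lambda>x. X x + Y x)"
      unfolding infinitesimal_isomorphism_def
    proof (intro exI conjI allI)
      show "real_analytic_at (\<lambda>t. \<xi> i t + \<zeta> i t) 0" for i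
        using \<xi>(1) \<zeta>(1) by (rule real_analytic_at_add)
      show "real_analytic_at (\<lambda>t. \<phi> t + \<psi> t) (f 0)"
        using \<xi>(2) \<zeta>(2) by (rule real_analytic_at_add)
      show "\<forall>\<^sub>F x in nhds 0. X x + Y x = (\<chi> i. \<xi> i (x $ i) + \<zeta> i (x $ i))"
        using \<xi>(3) \<zeta>(3) by eventually_elim (simp add: vec_eq_iff)
      show "\<forall>\<^sub>F x in nhds 0. frechet_derivative f (at x) (X x + Y x) = \<phi> (f x) + \<psi> (f x)"
        using \<xi>(4) \<zeta>(4) lin by eventually_elim (simp add: linear_add)
    qed
    moreover have "x + y = germ (\<lambda>x. X x + Y x)"
      unfolding X(1) Y(1) by (rule plus_vector_field_germ.abs_eq)
    ultimately show "x + y \<in> {germ X |X. infinitesimal_isomorphism f X}" by blast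
  next
    fix s x assume "x \<in> {germ X |X. infinitesimal_isomorphism f X}"
    then obtain X where X: "x = germ X" "infinitesimal_isomorphism f X" by blast
    obtain \<xi> \<phi> where \<xi>: "\<And>i. real_analytic_at (\<xi> i) (0::real)" "real_analytic_at \<phi> (f 0)"
      "\<forall>\<^sub>F x in nhds 0. X x = (\<chi> i. \<xi> i (x $ i))"
      "\<forall>\<^sub>F x in nhds 0. frechet_derivative f (at x) (X x) = \<phi> (f x)"
      using X(2) unfolding infinitesimal_isomorphism_def by blast
    have "infinitesimal_isomorphism f (\<lambda>x. s *\<^sub>R X x)"
      unfolding infinitesimal_isomorphism_def
    proof (intro exI conjI allI)
      show "real_analytic_at (\<lambda>t. s *\<^sub>R \<xi> i t) 0" for i
        using \<xi>(1) by (rule real_analytic_at_bounded_linear[OF bounded_linear_scaleR_right])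
      show "real_analytic_at (\<lambda>t. s *\<^sub>R \<phi> t) (f 0)"
        using \<xi>(2) by (rule real_analytic_at_bounded_linear[OF bounded_linear_scaleR_right])
      show "\<forall>\<^sub>F x in nhds 0. s *\<^sub>R X x = (\<chi> i. s *\<^sub>R \<xi> i (x $ i))"
        using \<xi>(3) by eventually_elim (simp add: vec_eq_iff)
      show "\<forall>\<^sub>F x in nhds 0. frechet_derivative f (at x) (s *\<^sub>R X x) = s *\<^sub>R \<phi> (f x)"
        using \<xi>(4) lin by eventually_elim (simp add: linear_scale)
    qed
    moreover have "s *\<^sub>R x = germ (\<lambda>x. s *\<^sub>R X x)"
      unfolding X(1) by (rule scaleR_vector_field_germ.abs_eq)
    ultimately show "s *\<^sub>R x \<in> {germ X |X. infinitesimal_isomorphism f X}" by blast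
  qed
qed

text \<open>The finite spanning set is asserted separately because \<open>dim\<close> is 0 by
  default for infinite-dimensional spaces, where the bound alone would say nothing.\<close>

theorem mainTheorem4:
  fixes f :: "real ^ 'n \<Rightarrow> real"
  assumes "web (coordinate_web f)"
    and "\<not> parallelizable (coordinate_web f)"
  shows "(\<exists>B. finite B \<and> isomorphism_algebra f \<subseteq> span B) \<and>
         dim (isomorphism_algebra f) \<le> CARD('n)"
proof -
  let ?g = "isomorphism_algebra f"
  have "real_analytic_at f 0"
    using assms(1) by (auto simp: web_def analytic_submersion_def coordinate_web_def dest: spec[of _ None])
  hence sub: "subspace ?g" by (rule subspace_isomorphism_algebra)
  have "x = 0" if "x \<in> ?g" "germ_value x = 0" for x
  proof -
    from that(1) obtain X where X: "x = germ X" "infinitesimal_isomorphism f X"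
      by (auto simp: isomorphism_algebra_def)
    have "X 0 = 0" using that(2) by (simp add: X germ_value.abs_eq)
    with isotropy_trivial[OF assms X(2)] show "x = 0"
      unfolding X(1) zero_vector_field_germ_def by (intro vector_field_germ.abs_eq_iff[THEN iffD2])
  qed
  hence inj: "inj_on germ_value ?g"
    using linear_inj_on_iff_eq_0[OF linear_germ_value sub] by blast
  obtain B where B: "B \<subseteq> ?g" "independent B" "?g \<subseteq> span B"
    using maximal_independent_subset by blast
  have span: "span B = ?g"
    using B sub by (metis span_minimal subset_antisym)
  \<comment> \<open>Evaluation carries a basis of the algebra to independent vectors of
    \<open>real ^ 'n\<close>, which bounds its cardinality.\<close>
  hence "independent (germ_value ` B)"
    using linear_independent_injective_image[OF linear_germ_value B(2)] inj by simp
  hence "finite (germ_value ` B)" "card (germ_value ` B) \<le> CARD('n)"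
    using independent_bound[of "germ_value ` B"] by auto
  moreover have "inj_on germ_value B"
    using inj B(1) by (rule inj_on_subset)
  ultimately have "finite B" "card B \<le> CARD('n)"
    by (simp_all add: finite_image_iff card_image)
  moreover have "span B = span ?g"
    using span sub by (metis span_eq_iff)
  hence "dim ?g = card B"
    using B(2) by (rule dim_eq_card)
  ultimately show ?thesis using B(3) by auto
qed

end
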